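(* Let $(a_n)_{n\ge0}$ be the sequence, listed in increasing order, of the non-negative integers $m$ such that $240m+49$ is a perfect square. Then $$\sum_{n=0}^\infty(-1)^{\lfloor 5n/4\rfloor}q^{a_n}=\frac{(q,q^7,q^8;q^8)_\infty\,(q^6,q^{10};q^{16})_\infty}{(q^2,q^3;q^5)_\infty}.$$
   Context: Here $q$ is a complex number with $|q|<1$ (equivalently, the identity may be read as an identity of formal power series in $q$). For a complex number $a$, $(a;q)_\infty:=\prod_{i=0}^\infty(1-aq^i)$, and $(a_1,a_2,\dots,a_m;q)_\infty:=\prod_{j=1}^m(a_j;q)_\infty$. $\lfloor x\rfloor$ is the floor function. *)

theory Defs
  imports
    "HOL-Analysis.Analysis"
    "HOL-Library.Infinite_Set"
    "HOL-Computational_Algebra.Nth_Powers"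
begin

definition qpoch_inf :: "complex \<Rightarrow> complex \<Rightarrow> complex" where
  "qpoch_inf a q = (\<Prod>i. 1 - a * q ^ i)"

definition qpochs_inf :: "complex list \<Rightarrow> complex \<Rightarrow> complex" where
  "qpochs_inf as q = (\<Prod>a\<leftarrow>as. qpoch_inf a q)"

definition square_indices :: "nat set" where
  "square_indices = {m. is_square (240 * m + 49)}"

definition a_seq :: "nat \<Rightarrow> nat" where
  "a_seq n = enumerate square_indices n"

text \<open>The index set is infinite, so \<^const>\<open>enumerate\<close> really lists it in increasing order.\<close>

lemma infinite_square_indices: "infinite square_indices"
proof -
  have "inj (\<lambda>j::nat. 60 * j\<^sup>2 + 7 * j)"
    by (rule strict_mono_imp_inj_on, rule strict_monoI)
       (simp add: add_le_less_mono power_mono)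
  hence "infinite (range (\<lambda>j::nat. 60 * j\<^sup>2 + 7 * j))"
    by (rule range_inj_infinite)
  moreover have "range (\<lambda>j::nat. 60 * j\<^sup>2 + 7 * j) \<subseteq> square_indices"
  proof clarify
    fix j :: nat
    have "240 * (60 * j\<^sup>2 + 7 * j) + 49 = (120 * j + 7)\<^sup>2"
      by (simp add: power2_eq_square algebra_simps)
    thus "60 * j\<^sup>2 + 7 * j \<in> square_indices"
      unfolding square_indices_def is_nth_power_def by blast
  qed
  ultimately show ?thesis
    using finite_subset by blast
qed

lemma strict_mono_a_seq: "strict_mono a_seq"
  unfolding a_seq_def
  using strict_mono_enumerate[OF infinite_square_indices] by simp

lemma range_a_seq: "range a_seq = square_indices"
  unfolding a_seq_def
  using range_enumerate[OF infinite_square_indices] by simp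

text \<open>For \<open>|q| < 1\<close> the products converge in the sense of \<^const>\<open>convergent_prod\<close>,
  so \<^const>\<open>prodinf\<close> is their actual value.\<close>

lemma convergent_prod_qpoch:
  fixes a q :: complex
  assumes "norm q < 1"
  shows "convergent_prod (\<lambda>i. 1 - a * q ^ i)"
proof -
  have "summable (\<lambda>i. norm a * norm q ^ i)"
    using assms by (intro summable_mult summable_geometric) simp
  hence "summable (\<lambda>i. norm ((1 - a * q ^ i) - 1))"
    by (simp add: norm_mult norm_power)
  thus ?thesis
    by (metis abs_convergent_prod_imp_convergent_prod summable_imp_abs_convergent_prod)
qed

end

theory Submission
  imports Defs
begin

text \<open>
  Write \<open>\<theta>(z) = (z, p/z, p; p)\<^sub>\<infinity>\<close> with \<open>p = q\<^sup>4\<^sup>0\<close>. Sorting the integers \<open>x\<close> with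
  \<open>x\<^sup>2 \<equiv> 49 (mod 240)\<close> into their classes modulo 120 turns the series into a sum of four theta
  series, and the quintuple product identity with base \<open>p\<close> evaluates these in pairs, giving
  \<open>(p;p)\<^sub>\<infinity> (\<theta>(q\<^sup>1\<^sup>8)/\<theta>(-q\<^sup>9) - q \<theta>(q\<^sup>2)/\<theta>(-q))\<close>. After multiplication by
  \<open>\<theta>(q\<^sup>1\<^sup>2) \<theta>(-q\<^sup>1\<^sup>5) \<theta>(-q) \<theta>(-q\<^sup>9)\<close> the difference is a case of the three-term relation
  of Weierstrass, which collapses it to \<open>\<theta>(q\<^sup>1\<^sup>0) \<theta>(q\<^sup>1\<^sup>6) \<theta>(-q\<^sup>3) \<theta>(-q\<^sup>1\<^sup>3)\<close>; comparing
  factors modulo 80 gives the product side. The three-term relation holds because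
  \<open>\<theta>(xy) \<theta>(x/y)\<close> is, up to a factor \<open>x\<close>, a \<open>2 \<times> 2\<close> determinant in \<open>x\<close> and \<open>y\<close>, so that it is a
  Pluecker relation.
\<close>

section \<open>Jacobi's triple product\<close>

text \<open>The two-sided Jacobi theta series with nome \<open>r\<close>, that is, base
  \<open>p = r\<^sup>2\<close>. Working with \<open>r\<close> keeps all exponents integral; the
  function \<theta>(z) of the overview is \<open>jacobi_theta r (- z / r)\<close>.\<close>

definition jacobi_theta :: "complex \<Rightarrow> complex \<Rightarrow> complex" where
  "jacobi_theta r w = (\<Sum>\<^sub>\<infinity>n::int. r powi (n\<^sup>2) * w powi n)"

text \<open>The term equals \<open>(x ^ n * w) ^ n\<close>, and \<open>x ^ n * w\<close> tends to 0,
  so a geometric series of ratio 1/2 eventually dominates.\<close>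

lemma summable_gaussian_power:
  fixes x w :: real
  assumes "0 < x" "x < 1" "0 < w"
  shows "summable (\<lambda>n. x ^ (n\<^sup>2) * w ^ n)"
proof -
  have "(\<lambda>n. x ^ n * w) \<longlonglongrightarrow> 0"
    using assms by (intro tendsto_mult_left_zero LIMSEQ_power_zero) auto
  hence "eventually (\<lambda>n. x ^ n * w < 1/2) sequentially"
    by (rule order_tendstoD) simp
  hence "eventually (\<lambda>n. norm (x ^ (n\<^sup>2) * w ^ n) \<le> (1/2) ^ n) sequentially"
  proof eventually_elim
    case (elim n)
    have "x ^ (n\<^sup>2) * w ^ n = (x ^ n * w) ^ n"
      by (simp add: power_mult_distrib power_mult power2_eq_square)
    also have "\<dots> \<le> (1/2) ^ n"
      using elim assms by (intro power_mono) auto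
    finally show ?case using assms by simp
  qed
  thus ?thesis
    by (rule summable_comparison_test_ev) (simp add: summable_geometric)
qed

text \<open>The integers are covered by \<open>n \<ge> 0\<close> and \<open>n \<le> 0\<close>, and
  the second half is the first one with \<open>w\<close> inverted.\<close>

lemma abs_summable_jacobi_theta:
  fixes r w :: complex
  assumes "norm r < 1" "r \<noteq> 0" "w \<noteq> 0"
  shows "(\<lambda>n::int. norm (r powi (n\<^sup>2) * w powi n)) summable_on UNIV"
proof -
  let ?f = "\<lambda>n::int. norm (r powi (n\<^sup>2) * w powi n)"
  have sq: "r powi ((int n)\<^sup>2) = r ^ (n\<^sup>2)" for n
    by (metis of_nat_power power_int_of_nat)
  have "(\<lambda>n::nat. ?f (int n)) summable_on UNIV"
    using summable_gaussian_power[of "norm r" "norm w"] assms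
    by (subst summable_on_UNIV_nonneg_real_iff) (auto simp: norm_mult norm_power sq)
  hence 1: "?f summable_on range int"
    by (subst summable_on_reindex) (auto simp: o_def)
  have "(\<lambda>n::nat. ?f (- int n)) summable_on UNIV"
    using summable_gaussian_power[of "norm r" "inverse (norm w)"] assms
    by (subst summable_on_UNIV_nonneg_real_iff)
       (auto simp: norm_mult norm_power norm_inverse sq power_int_minus power_inverse)
  hence 2: "?f summable_on range (\<lambda>n. - int n)"
    by (subst summable_on_reindex) (auto simp: o_def inj_on_def)
  have "(UNIV :: int set) = range int \<union> range (\<lambda>n. - int n)"
    by (auto simp: image_iff) (metis int_cases2)
  with 1 2 show ?thesis
    by (metis (no_types, lifting) summable_on_union)
qed

lemma summable_jacobi_theta:
  fixes r w :: complex
  assumes "norm r < 1" "r \<noteq> 0" "w \<noteq> 0"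
  shows "(\<lambda>n::int. r powi (n\<^sup>2) * w powi n) summable_on UNIV"
  using abs_summable_jacobi_theta[OF assms] by (rule abs_summable_summable)

lemma has_sum_jacobi_theta:
  fixes r w :: complex
  assumes "norm r < 1" "r \<noteq> 0" "w \<noteq> 0"
  shows "((\<lambda>n::int. r powi (n\<^sup>2) * w powi n) has_sum jacobi_theta r w) UNIV"
  unfolding jacobi_theta_def using summable_jacobi_theta[OF assms] by (rule has_sum_infsum)

section \<open>Gaussian binomials and the finite triple product\<close>

text \<open>The Gaussian binomial coefficient, given by the q-Pascal rule so that no division is
  involved. Where \<open>n - k\<close> is truncated, the coefficient it multiplies is 0.\<close>

fun qbinomial :: "'a::comm_ring_1 \<Rightarrow> nat \<Rightarrow> nat \<Rightarrow> 'a" where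
  "qbinomial p n 0 = 1"
| "qbinomial p 0 (Suc k) = 0"
| "qbinomial p (Suc n) (Suc k) = qbinomial p n (Suc k) + p ^ (n - k) * qbinomial p n k"

lemma qbinomial_eq_0: "n < k \<Longrightarrow> qbinomial p n k = 0"
  by (induction p n k rule: qbinomial.induct) auto

text \<open>The factorial formula with denominators cleared. Under the Pascal rule it comes down to
  \<open>(1 - p ^ (n - k)) + p ^ (n - k) * (1 - p ^ Suc k) = 1 - p ^ Suc n\<close>.\<close>

lemma qbinomial_mult_prod:
  fixes p :: "'a::comm_ring_1"
  assumes "k \<le> n"
  shows "qbinomial p n k * (\<Prod>i<k. 1 - p ^ Suc i) * (\<Prod>i<n-k. 1 - p ^ Suc i) = (\<Prod>i<n. 1 - p ^ Suc i)"
  using assms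
proof (induction p n k rule: qbinomial.induct)
  case (3 p n k)
  let ?P = "\<lambda>n. \<Prod>i<n. 1 - p ^ Suc i"
  have k: "k \<le> n" using 3 by simp
  have IH2: "qbinomial p n k * ?P k * ?P (n - k) = ?P n"
    using 3 by simp
  \<comment> \<open>In the boundary case \<open>k = n\<close> both sides vanish: the left through
    the coefficient, the right through \<open>1 - p ^ 0\<close>.\<close>
  have IH1: "qbinomial p n (Suc k) * ?P (Suc k) * ?P (n - k) = ?P n * (1 - p ^ (n - k))"
  proof (cases "k = n")
    case True
    thus ?thesis by (simp add: qbinomial_eq_0)
  next
    case False
    hence "n - k = Suc (n - Suc k)" using k by simp
    hence "?P (n - k) = ?P (n - Suc k) * (1 - p ^ (n - k))"
      by (simp only: prod.lessThan_Suc)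
    moreover have "qbinomial p n (Suc k) * ?P (Suc k) * ?P (n - Suc k) = ?P n"
      using 3 False k by simp
    ultimately show ?thesis by (metis mult.assoc)
  qed
  have "p ^ (n - k) * p ^ Suc k = p ^ Suc n"
    using k by (simp only: flip: power_add) simp
  hence e: "1 - p ^ (n - k) + p ^ (n - k) * (1 - p ^ Suc k) = 1 - p ^ Suc n"
    by (simp add: algebra_simps)
  have "qbinomial p (Suc n) (Suc k) * ?P (Suc k) * ?P (n - k)
      = qbinomial p n (Suc k) * ?P (Suc k) * ?P (n - k)
        + p ^ (n - k) * (1 - p ^ Suc k) * (qbinomial p n k * ?P k * ?P (n - k))"
    by (simp add: algebra_simps)
  also have "\<dots> = ?P n * (1 - p ^ (n - k) + p ^ (n - k) * (1 - p ^ Suc k))"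
    unfolding IH1 IH2 by (simp add: algebra_simps)
  also have "\<dots> = ?P (Suc n)"
    unfolding e by simp
  finally show ?case by simp
qed auto

text \<open>Multiplying by the new factor \<open>1 + x * p ^ n\<close> reproduces the Pascal rule:
  \<open>p ^ n\<close> splits as \<open>p ^ (n - k) * p ^ k\<close>, and \<open>p ^ k\<close> is the
  step between consecutive triangular exponents.\<close>

lemma qbinomial_theorem:
  fixes p x :: "'a::comm_ring_1"
  shows "(\<Prod>i<n. 1 + x * p ^ i) = (\<Sum>k\<le>n. qbinomial p n k * p ^ (k * (k - 1) div 2) * x ^ k)"
proof (induction n)
  case (Suc n)
  let ?t = "\<lambda>n k. qbinomial p n k * p ^ (k * (k - 1) div 2) * x ^ k"
  have tri: "Suc k * k div 2 = k * (k - 1) div 2 + k" for k :: nat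
  proof -
    have "Suc k * k = k * (k - 1) + k * 2"
      by (cases k) (auto simp: algebra_simps)
    thus ?thesis by simp
  qed
  have step: "?t (Suc n) (Suc k) = ?t n (Suc k) + x * p ^ n * ?t n k" if "k \<le> n" for k
  proof -
    have "p ^ (n - k) * p ^ k = p ^ n"
      using that by (simp flip: power_add)
    hence "x * p ^ n * (qbinomial p n k * p ^ (k * (k - 1) div 2) * x ^ k)
        = x * (p ^ (n - k) * p ^ k) * (qbinomial p n k * p ^ (k * (k - 1) div 2) * x ^ k)"
      by simp
    thus ?thesis unfolding qbinomial.simps diff_Suc_1 tri power_add
      by (simp add: algebra_simps)
  qed
  have "(\<Sum>k\<le>Suc n. ?t (Suc n) k) = 1 + (\<Sum>k\<le>n. ?t (Suc n) (Suc k))"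
    by (subst sum.atMost_Suc_shift) simp
  also have "(\<Sum>k\<le>n. ?t (Suc n) (Suc k)) = (\<Sum>k\<le>n. ?t n (Suc k)) + x * p ^ n * (\<Sum>k\<le>n. ?t n k)"
    using step by (simp add: sum.distrib sum_distrib_left del: qbinomial.simps)
  also have "1 + (\<dots>) = (\<Sum>k\<le>Suc n. ?t n k) + x * p ^ n * (\<Sum>k\<le>n. ?t n k)"
    by (subst sum.atMost_Suc_shift) simp
  also have "(\<Sum>k\<le>Suc n. ?t n k) = (\<Sum>k\<le>n. ?t n k)"
    by (simp add: qbinomial_eq_0)
  finally show ?case
    using Suc by (simp add: algebra_simps)
qed auto

lemma qpoch_inf_LIMSEQ:
  assumes "norm q < 1"
  shows "(\<lambda>n. \<Prod>i<n. 1 - a * q ^ i) \<longlonglongrightarrow> qpoch_inf a q"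
proof (rule LIMSEQ_offset[where k = 1])
  show "(\<lambda>n. \<Prod>i<n + 1. 1 - a * q ^ i) \<longlonglongrightarrow> qpoch_inf a q"
    using convergent_prod_LIMSEQ[OF convergent_prod_qpoch[OF assms, of a]]
    by (simp add: qpoch_inf_def lessThan_Suc_atMost)
qed

lemma qpoch_inf_nonzero:
  fixes a q :: complex
  assumes "norm q < 1" "norm a < 1"
  shows "qpoch_inf a q \<noteq> 0"
  unfolding qpoch_inf_def
proof (rule prodinf_nonzero[OF convergent_prod_qpoch[OF assms(1)]])
  fix i
  have "norm (a * q ^ i) < 1"
    using assms by (simp add: norm_mult norm_power)
      (meson mult_left_le norm_ge_zero order_le_less_trans power_le_one less_imp_le)
  thus "1 - a * q ^ i \<noteq> 0" by auto
qed

text \<open>The q-binomial theorem for \<open>2 * N\<close> factors in base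
  \<open>r\<^sup>2\<close>, recentred at the middle index \<open>N\<close>.\<close>

lemma finite_jacobi_triple_product:
  fixes r w :: complex
  assumes "r \<noteq> 0" "w \<noteq> 0"
  shows "(\<Prod>i<N. 1 + w * r ^ (2 * i + 1)) * (\<Prod>i<N. 1 + r ^ (2 * i + 1) / w)
    = (\<Sum>k\<in>{-int N..int N}. qbinomial (r\<^sup>2) (2 * N) (nat (int N + k)) * (r powi (k\<^sup>2) * w powi k))"
proof -
  \<comment> \<open>With \<open>x\<close> equal to \<open>w\<close> times the power of
    \<open>r\<close> with exponent 1 - 2N, the factors \<open>1 + x * (r\<^sup>2) ^ i\<close> carry
    all odd powers of \<open>r\<close> from 1 - 2N to 2N - 1. The lower half, read backwards, gives
    the factors in \<open>1 / w\<close>, with \<open>c\<close> as the monomial pulled out of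
    them.\<close>
  define x where "x = w / r ^ (2 * N) * r"
  define c where "c = w ^ N / r ^ (N\<^sup>2)"
  have c0: "c \<noteq> 0" using assms by (simp add: c_def)
  have first: "(\<Prod>i<N. 1 + x * (r\<^sup>2) ^ i) = c * (\<Prod>i<N. 1 + r ^ (2 * i + 1) / w)"
  proof -
    have "(\<Prod>i<N. 1 + x * (r\<^sup>2) ^ i) = (\<Prod>i<N. 1 + x * (r\<^sup>2) ^ (N - Suc i))"
      by (rule prod.nat_diff_reindex [symmetric])
    also have "\<dots> = (\<Prod>i<N. w / r ^ (2 * i + 1) * (1 + r ^ (2 * i + 1) / w))"
    proof (rule prod.cong)
      fix i assume i: "i \<in> {..<N}"
      have "r ^ (2 * N) = (r\<^sup>2) ^ (N - Suc i) * r ^ (2 * i + 1) * r"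
        using i unfolding power_mult[symmetric] power_add[symmetric] power_Suc2[symmetric]
        by (intro arg_cong[where f = "power r"]) (auto simp: algebra_simps)
      hence "x * (r\<^sup>2) ^ (N - Suc i) = w / r ^ (2 * i + 1)"
        using assms by (simp add: x_def divide_simps)
      thus "1 + x * (r\<^sup>2) ^ (N - Suc i) = w / r ^ (2 * i + 1) * (1 + r ^ (2 * i + 1) / w)"
        using assms by (simp add: field_simps)
    qed simp
    also have "\<dots> = (\<Prod>i<N. w / r ^ (2 * i + 1)) * (\<Prod>i<N. 1 + r ^ (2 * i + 1) / w)"
      by (rule prod.distrib)
    also have "(\<Prod>i<N. w / r ^ (2 * i + 1)) = c"
      unfolding c_def by (induction N) (auto simp: power2_eq_square power_add field_simps mult_2_right)
    finally show ?thesis .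
  qed
  have second: "(\<Prod>i<N. 1 + x * (r\<^sup>2) ^ (N + i)) = (\<Prod>i<N. 1 + w * r ^ (2 * i + 1))"
    using assms by (intro prod.cong) (auto simp: x_def power_add power_mult)
  have "(\<Prod>i<N+M. 1 + x * (r\<^sup>2) ^ i) = (\<Prod>i<N. 1 + x * (r\<^sup>2) ^ i) * (\<Prod>i<M. 1 + x * (r\<^sup>2) ^ (N + i))" for M
    by (induction M) (simp_all add: mult.assoc)
  from this[of N] have prods: "(\<Prod>i<2*N. 1 + x * (r\<^sup>2) ^ i)
      = c * ((\<Prod>i<N. 1 + w * r ^ (2 * i + 1)) * (\<Prod>i<N. 1 + r ^ (2 * i + 1) / w))"
    unfolding first second mult_2 by (simp only: ac_simps)
  have "(\<Prod>i<2*N. 1 + x * (r\<^sup>2) ^ i)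
      = (\<Sum>k\<le>2*N. qbinomial (r\<^sup>2) (2*N) k * (r\<^sup>2) ^ (k * (k - 1) div 2) * x ^ k)"
    by (rule qbinomial_theorem)
  also have "\<dots> = (\<Sum>k\<in>{-int N..int N}. c * (qbinomial (r\<^sup>2) (2 * N) (nat (int N + k)) * (r powi (k\<^sup>2) * w powi k)))"
  proof (rule sum.reindex_bij_witness[where i = "\<lambda>k. nat (int N + k)" and j = "\<lambda>k. int k - int N"])
    fix k assume "k \<in> {..2*N}"
    have "(r\<^sup>2) ^ (k * (k - 1) div 2) = r ^ (k * (k - 1))"
      unfolding power_mult[symmetric] by (cases k) auto
    hence "(r\<^sup>2) ^ (k * (k - 1) div 2) * x ^ k = r powi (int (k * (k - 1))) * (r powi (1 - 2 * int N)) ^ k * w ^ k"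
      using assms by (simp add: x_def power_mult_distrib power_divide power_int_diff power_int_mult power_mult)
    also have "r powi (int (k * (k - 1))) * (r powi (1 - 2 * int N)) ^ k = r powi (int (k * (k - 1)) + (1 - 2 * int N) * int k)"
      using assms by (simp add: power_int_add power_int_power')
    \<comment> \<open>Completing the square produces the theta exponent; the leftover
      \<open>- (int N)\<^sup>2\<close> is the denominator of \<open>c\<close>.\<close>
    also have "int (k * (k - 1)) + (1 - 2 * int N) * int k = (int k - int N)\<^sup>2 - (int N)\<^sup>2"
      by (cases k) (auto simp: power2_eq_square algebra_simps)
    also have "r powi \<dots> * w ^ k = c * (r powi ((int k - int N)\<^sup>2) * w powi (int k - int N))"
      using assms by (simp add: c_def power_int_diff power_int_mult power2_eq_square flip: of_nat_mult)
    finally show "c * (qbinomial (r\<^sup>2) (2 * N) (nat (int N + (int k - int N))) * (r powi ((int k - int N)\<^sup>2) * w powi (int k - int N)))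
       = qbinomial (r\<^sup>2) (2*N) k * (r\<^sup>2) ^ (k * (k - 1) div 2) * x ^ k"
      by simp
  qed auto
  also have "\<dots> = c * (\<Sum>k\<in>{-int N..int N}. qbinomial (r\<^sup>2) (2 * N) (nat (int N + k)) * (r powi (k\<^sup>2) * w powi k))"
    by (rule sum_distrib_left [symmetric])
  finally show ?thesis
    using prods c0 by simp
qed

section \<open>Passage to the limit\<close>

text \<open>Tannery's theorem: absolutely convergent sums are integrals over counting measure, so
  dominated convergence applies.\<close>

lemma tendsto_infsum_dominated:
  fixes f :: "nat \<Rightarrow> 'a \<Rightarrow> complex" and g :: "'a \<Rightarrow> complex" and h :: "'a \<Rightarrow> real"
  assumes lim: "\<And>x. (\<lambda>n. f n x) \<longlonglongrightarrow> g x"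
    and bound: "\<And>n x. norm (f n x) \<le> h x" and h: "h summable_on UNIV"
  shows "(\<lambda>n. infsum (f n) UNIV) \<longlonglongrightarrow> infsum g UNIV"
proof -
  have h0: "h x \<ge> 0" for x
    using bound[of 0 x] norm_ge_zero order_trans by blast
  have "Infinite_Set_Sum.abs_summable_on h UNIV"
    using h h0 by (simp flip: abs_summable_equivalent)
  hence ih: "integrable (count_space UNIV) h"
    by (simp add: abs_summable_on_def)
  have gb: "norm (g x) \<le> h x" for x
    by (rule LIMSEQ_le_const2[OF tendsto_norm[OF lim]]) (use bound in auto)
  have conv: "infsum u UNIV = integral\<^sup>L (count_space UNIV) u" if "\<And>x. norm (u x) \<le> h x" for u :: "'a \<Rightarrow> complex"
  proof -
    have "integrable (count_space UNIV) u"
      by (rule Bochner_Integration.integrable_bound[OF ih]) (use that h0 in auto)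
    thus ?thesis
      using infsetsum_infsum[of u UNIV] by (simp add: abs_summable_on_def infsetsum_def)
  qed
  have "(\<lambda>n. integral\<^sup>L (count_space UNIV) (f n)) \<longlonglongrightarrow> integral\<^sup>L (count_space UNIV) g"
    by (rule integral_dominated_convergence[where w = h]) (use lim bound ih in auto)
  thus ?thesis
    using conv[of g] conv[of "f _"] gb bound by simp
qed

text \<open>Let \<open>N\<close> tend to infinity in the finite identity. Each coefficient tends to
  \<open>1 / qpoch_inf (r\<^sup>2) (r\<^sup>2)\<close>, and the coefficients are bounded uniformly,
  so the absolute theta series is a majorant.\<close>

lemma jacobi_triple_product:
  fixes r w :: complex
  assumes "norm r < 1" "r \<noteq> 0" "w \<noteq> 0"
  shows "jacobi_theta r w = qpoch_inf (r\<^sup>2) (r\<^sup>2) * qpoch_inf (- w * r) (r\<^sup>2) * qpoch_inf (- r / w) (r\<^sup>2)"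
proof -
  have r2: "norm (r\<^sup>2) < 1"
    using assms by (simp add: norm_power power_less_one_iff)
  define P where "P n = (\<Prod>i<n. 1 - r\<^sup>2 ^ Suc i)" for n
  define L where "L = qpoch_inf (r\<^sup>2) (r\<^sup>2)"
  have P: "P \<longlonglongrightarrow> L"
    using qpoch_inf_LIMSEQ[OF r2, of "r\<^sup>2"] by (simp add: P_def[abs_def] L_def)
  have L0: "L \<noteq> 0"
    unfolding L_def using r2 by (intro qpoch_inf_nonzero)
  have P0: "P n \<noteq> 0" for n
  proof -
    have "norm (r\<^sup>2 ^ Suc i) < 1" for i
      by (metis r2 norm_power norm_ge_zero power_less_one_iff zero_less_Suc)
    hence "r\<^sup>2 ^ Suc i \<noteq> 1" for i
      by (metis norm_one less_irrefl)
    thus ?thesis unfolding P_def by (simp add: right_minus_eq)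
  qed
  \<comment> \<open>Extending the coefficients by 0 makes every finite sum a sum over all integers,
    as the limit theorem requires.\<close>
  define C where "C N k = (if \<bar>k\<bar> \<le> int N then qbinomial (r\<^sup>2) (2 * N) (nat (int N + k)) else 0)" for N k
  have C_eq: "C N k = P (2 * N) * inverse (P (nat (int N + k))) * inverse (P (nat (int N - k)))"
    if "\<bar>k\<bar> \<le> int N" for N k
  proof -
    have "2 * N - nat (int N + k) = nat (int N - k)" and le: "nat (int N + k) \<le> 2 * N"
      using that by auto
    moreover have "qbinomial (r\<^sup>2) (2 * N) (nat (int N + k)) * P (nat (int N + k)) * P (2 * N - nat (int N + k)) = P (2 * N)"
      unfolding P_def by (rule qbinomial_mult_prod[OF le])
    ultimately show ?thesis
      using that P0 by (simp add: C_def divide_simps mult.assoc)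
  qed
  have C_lim: "(\<lambda>N. C N k) \<longlonglongrightarrow> inverse L" for k
  proof -
    have lim: "filterlim (\<lambda>N. nat (int N + k)) sequentially sequentially" for k
      unfolding filterlim_at_top eventually_sequentially
    proof
      fix Z :: nat
      show "\<exists>N. \<forall>n\<ge>N. Z \<le> nat (int n + k)"
        by (intro exI[of _ "Z + nat \<bar>k\<bar>"]) auto
    qed
    have "(\<lambda>N. P (2 * N)) \<longlonglongrightarrow> L"
      using P by (rule filterlim_compose) (simp add: mult_nat_left_at_top)
    moreover have "(\<lambda>N. P (nat (int N + k))) \<longlonglongrightarrow> L" "(\<lambda>N. P (nat (int N - k))) \<longlonglongrightarrow> L"
      using filterlim_compose[OF P lim[of k]] filterlim_compose[OF P lim[of "- k"]] by simp_all
    ultimately have "(\<lambda>N. P (2 * N) * inverse (P (nat (int N + k))) * inverse (P (nat (int N - k)))) \<longlonglongrightarrow> L * inverse L * inverse L"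
      using L0 by (intro tendsto_intros)
    moreover have "eventually (\<lambda>N. C N k = P (2 * N) * inverse (P (nat (int N + k))) * inverse (P (nat (int N - k)))) sequentially"
      unfolding eventually_sequentially
      by (intro exI[of _ "nat \<bar>k\<bar>"]) (auto intro!: C_eq)
    ultimately show ?thesis
      using L0 by (simp add: tendsto_cong)
  qed
  \<comment> \<open>\<open>P\<close> converges to a nonzero limit, so both \<open>P\<close> and its
    inverse are bounded; this bounds \<open>C N k\<close> independently of \<open>N\<close> and
    \<open>k\<close>.\<close>
  obtain M where M: "M > 0" "\<And>n. norm (P n) \<le> M"
    using convergent_imp_Bseq[of P] P by (auto simp: convergent_def elim!: BseqE)
  obtain M' where M': "M' > 0" "\<And>n. norm (inverse (P n)) \<le> M'"
    using convergent_imp_Bseq[of "\<lambda>n. inverse (P n)"] tendsto_inverse[OF P L0]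
    by (auto simp: convergent_def elim!: BseqE)
  have C_bound: "norm (C N k) \<le> M * M' * M'" for N k
  proof (cases "\<bar>k\<bar> \<le> int N")
    case True
    show ?thesis unfolding C_eq[OF True] norm_mult
      using M M' by (intro mult_mono) (auto intro: less_imp_le)
  next
    case False
    thus ?thesis using M M' by (simp add: C_def)
  qed
  let ?t = "\<lambda>k. r powi (k\<^sup>2) * w powi k"
  have "(\<lambda>N. infsum (\<lambda>k. C N k * ?t k) UNIV) \<longlonglongrightarrow> infsum (\<lambda>k. inverse L * ?t k) UNIV"
  proof (rule tendsto_infsum_dominated)
    show "(\<lambda>k. M * M' * M' * norm (?t k)) summable_on UNIV"
      using abs_summable_jacobi_theta[OF assms] by (rule summable_on_cmult_right)
  next
    fix N k
    show "norm (C N k * ?t k) \<le> M * M' * M' * norm (?t k)"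
      unfolding norm_mult[of "C N k"] by (intro mult_right_mono C_bound) auto
  qed (intro tendsto_intros C_lim)
  moreover have "infsum (\<lambda>k. C N k * ?t k) UNIV
      = (\<Prod>i<N. 1 + w * r ^ (2 * i + 1)) * (\<Prod>i<N. 1 + r ^ (2 * i + 1) / w)" for N
  proof -
    have "infsum (\<lambda>k. C N k * ?t k) UNIV = infsum (\<lambda>k. C N k * ?t k) {-int N..int N}"
      by (rule infsum_cong_neutral) (auto simp: C_def)
    also have "\<dots> = (\<Sum>k\<in>{-int N..int N}. C N k * ?t k)"
      by simp
    also have "\<dots> = (\<Sum>k\<in>{-int N..int N}. qbinomial (r\<^sup>2) (2 * N) (nat (int N + k)) * ?t k)"
      by (intro sum.cong) (auto simp: C_def)
    finally show ?thesis
      using finite_jacobi_triple_product[OF assms(2,3)] by simp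
  qed
  moreover have "infsum (\<lambda>k. inverse L * ?t k) UNIV = inverse L * jacobi_theta r w"
    unfolding jacobi_theta_def by (rule infsum_cmult_right')
  moreover have "(\<lambda>N. (\<Prod>i<N. 1 + w * r ^ (2 * i + 1)) * (\<Prod>i<N. 1 + r ^ (2 * i + 1) / w))
      \<longlonglongrightarrow> qpoch_inf (- w * r) (r\<^sup>2) * qpoch_inf (- r / w) (r\<^sup>2)"
    using tendsto_mult[OF qpoch_inf_LIMSEQ[OF r2, of "- w * r"] qpoch_inf_LIMSEQ[OF r2, of "- r / w"]]
    by (simp add: power_mult mult.assoc)
  ultimately have "inverse L * jacobi_theta r w = qpoch_inf (- w * r) (r\<^sup>2) * qpoch_inf (- r / w) (r\<^sup>2)"
    using LIMSEQ_unique by fastforce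
  thus ?thesis
    using L0 by (simp add: L_def field_simps)
qed

section \<open>The three-term relation and the quintuple product\<close>

text \<open>Absolute convergence turns the product into an unordered double sum, which may then be
  regrouped along sublattices.\<close>

lemma has_sum_jacobi_theta_mult:
  fixes r s a b :: complex
  assumes "norm r < 1" "r \<noteq> 0" "a \<noteq> 0" "norm s < 1" "s \<noteq> 0" "b \<noteq> 0"
  shows "((\<lambda>(m::int, n::int). (r powi (m\<^sup>2) * a powi m) * (s powi (n\<^sup>2) * b powi n))
    has_sum (jacobi_theta r a * jacobi_theta s b)) UNIV"
proof -
  let ?f = "\<lambda>m::int. r powi (m\<^sup>2) * a powi m" and ?g = "\<lambda>n::int. s powi (n\<^sup>2) * b powi n"
  have "((\<lambda>(m, n). ?f m * ?g n) has_sum (jacobi_theta r a * jacobi_theta s b)) (UNIV \<times> UNIV)"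
  proof (rule has_sum_SigmaI)
    fix m
    show "((\<lambda>n. case (m, n) of (m, n) \<Rightarrow> ?f m * ?g n) has_sum ?f m * jacobi_theta s b) UNIV"
      using has_sum_cmult_right[OF has_sum_jacobi_theta[OF assms(4-6)], of "?f m"] by simp
  next
    show "((\<lambda>m. ?f m * jacobi_theta s b) has_sum jacobi_theta r a * jacobi_theta s b) UNIV"
      by (rule has_sum_cmult_left[OF has_sum_jacobi_theta[OF assms(1-3)]])
  next
    have "(\<lambda>x. norm ((\<lambda>(m, n). ?f m * ?g n) x)) summable_on (UNIV \<times> UNIV)"
    proof (subst Infinite_Sum.abs_summable_on_Sigma_iff, intro conjI ballI)
      fix m
      show "(\<lambda>n. norm (case (m, n) of (m, n) \<Rightarrow> ?f m * ?g n)) summable_on UNIV"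
        using summable_on_cmult_right[OF abs_summable_jacobi_theta[OF assms(4-6)], of "norm (?f m)"]
        by (simp add: norm_mult)
    next
      have "(\<Sum>\<^sub>\<infinity>n. norm (?f m * ?g n)) = norm (?f m) * (\<Sum>\<^sub>\<infinity>n. norm (?g n))" for m
        by (subst infsum_cmult_right'[symmetric]) (simp only: norm_mult)
      moreover have "(\<Sum>\<^sub>\<infinity>n. norm (?g n)) \<ge> 0"
        by (rule infsum_nonneg) simp
      ultimately show "(\<lambda>m. norm (\<Sum>\<^sub>\<infinity>n. norm (case (m, n) of (m, n) \<Rightarrow> ?f m * ?g n))) summable_on UNIV"
        using summable_on_cmult_left[OF abs_summable_jacobi_theta[OF assms(1-3)], of "\<Sum>\<^sub>\<infinity>n. norm (?g n)"]
        by (simp add: abs_mult)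
    qed
    thus "(\<lambda>(m, n). ?f m * ?g n) summable_on (UNIV \<times> UNIV)"
      by (rule abs_summable_summable)
  qed
  thus ?thesis by simp
qed

lemma jacobi_theta_inverse: "jacobi_theta r (1 / w) = jacobi_theta r w"
proof -
  have "jacobi_theta r (1 / w) = (\<Sum>\<^sub>\<infinity>n::int. r powi ((-n)\<^sup>2) * w powi (-n))"
    unfolding jacobi_theta_def by (simp add: power_int_divide_distrib power_int_minus divide_simps)
  also have "\<dots> = jacobi_theta r w"
    unfolding jacobi_theta_def
    by (rule infsum_reindex_bij_witness[where i = uminus and j = uminus]) auto
  finally show ?thesis .
qed

text \<open>Quasi-periodicity: replace \<open>n\<close> by \<open>n + 1\<close> and expand the
  square.\<close>

lemma jacobi_theta_shift:
  assumes "r \<noteq> 0" "w \<noteq> 0"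
  shows "r * w * jacobi_theta r (r\<^sup>2 * w) = jacobi_theta r w"
proof -
  have "r * w * jacobi_theta r (r\<^sup>2 * w) = (\<Sum>\<^sub>\<infinity>n::int. r powi ((n + 1)\<^sup>2) * w powi (n + 1))"
    unfolding jacobi_theta_def infsum_cmult_right'[symmetric]
  proof (rule infsum_cong)
    fix n :: int
    have "r powi ((n + 1)\<^sup>2) = r powi (n\<^sup>2) * (r\<^sup>2) powi n * r"
      using assms by (simp add: power2_sum power_int_add power_int_power mult.commute)
    thus "r * w * (r powi n\<^sup>2 * (r\<^sup>2 * w) powi n) = r powi ((n + 1)\<^sup>2) * w powi (n + 1)"
      using assms by (simp add: power_int_add power_int_mult_distrib)
  qed
  also have "\<dots> = jacobi_theta r w"
    unfolding jacobi_theta_def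
    by (rule infsum_reindex_bij_witness[where i = "\<lambda>n. n - 1" and j = "\<lambda>n. n + 1"]) auto
  finally show ?thesis .
qed

text \<open>Inversion and shift together show that the value is its own negative.\<close>

lemma jacobi_theta_eq_0:
  assumes "r \<noteq> 0"
  shows "jacobi_theta r (- (1 / r)) = 0"
proof -
  have "jacobi_theta r (1 / (- r)) = jacobi_theta r (- r)"
    by (rule jacobi_theta_inverse)
  moreover have "r * (- (1 / r)) * jacobi_theta r (r\<^sup>2 * (- (1 / r))) = jacobi_theta r (- (1 / r))"
    using assms by (intro jacobi_theta_shift) auto
  ultimately show ?thesis
    using assms by (simp add: power2_eq_square)
qed

text \<open>The substitution \<open>m = i + j\<close>, \<open>n = i - j\<close> diagonalises
  \<open>m\<^sup>2 + n\<^sup>2\<close> to \<open>2 * i\<^sup>2 + 2 * j\<^sup>2\<close>. It reaches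
  only the pairs with \<open>m + n\<close> even; the odd pairs are the same lattice with
  \<open>m\<close> shifted by 1 and give the second product.\<close>

lemma jacobi_theta_mult:
  fixes r a b :: complex
  assumes "norm r < 1" "r \<noteq> 0" "a \<noteq> 0" "b \<noteq> 0"
  shows "jacobi_theta r a * jacobi_theta r b =
    jacobi_theta (r\<^sup>2) (a * b) * jacobi_theta (r\<^sup>2) (a / b) +
    a * r * jacobi_theta (r\<^sup>2) (r\<^sup>2 * (a * b)) * jacobi_theta (r\<^sup>2) (r\<^sup>2 * (a / b))"
proof -
  let ?F = "\<lambda>(m::int, n::int). (r powi (m\<^sup>2) * a powi m) * (r powi (n\<^sup>2) * b powi n)"
  have r2: "norm (r\<^sup>2) < 1"
    using assms by (simp add: norm_power power_less_one_iff)
  define \<phi> where "\<phi> = (\<lambda>(i::int, j::int). (i + j, i - j))"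
  define \<psi> where "\<psi> = (\<lambda>(i::int, j::int). (i + j + 1, i - j))"
  have inj: "inj \<phi>" "inj \<psi>"
    by (auto simp: inj_on_def \<phi>_def \<psi>_def)
  have disj: "range \<phi> \<inter> range \<psi> = {}"
    by (auto simp: \<phi>_def \<psi>_def) presburger
  have un: "range \<phi> \<union> range \<psi> = UNIV"
  proof -
    have "(m, n) \<in> range \<phi> \<union> range \<psi>" for m n
    proof (cases "even (m + n)")
      case True
      then obtain i where "m + n = 2 * i" by (elim evenE)
      hence "(m, n) = \<phi> (i, i - n)"
        by (auto simp: \<phi>_def)
      thus ?thesis by blast
    next
      case False
      then obtain i where "m + n = 2 * i + 1" by (elim oddE)
      hence "(m, n) = \<psi> (i, i - n)"
        by (auto simp: \<psi>_def)
      thus ?thesis by blast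
    qed
    thus ?thesis by auto
  qed
  have "(?F \<circ> \<phi> has_sum (jacobi_theta (r\<^sup>2) (a * b) * jacobi_theta (r\<^sup>2) (a / b))) UNIV"
  proof -
    have eq: "(?F \<circ> \<phi>) = (\<lambda>(i, j). ((r\<^sup>2) powi (i\<^sup>2) * (a * b) powi i) * ((r\<^sup>2) powi (j\<^sup>2) * (a / b) powi j))"
    proof (intro ext, clarify, unfold o_def \<phi>_def prod.case)
      fix i j :: int
      have "r powi ((i + j)\<^sup>2) * r powi ((i - j)\<^sup>2) = (r\<^sup>2) powi (i\<^sup>2) * (r\<^sup>2) powi (j\<^sup>2)"
        using assms unfolding power_int_power
        by (simp flip: power_int_add) (simp add: power2_eq_square algebra_simps)
      moreover have "a powi (i + j) * b powi (i - j) = (a * b) powi i * (a / b) powi j"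
        using assms by (simp add: power_int_add power_int_diff power_int_mult_distrib power_int_divide_distrib)
      ultimately have "(r powi ((i + j)\<^sup>2) * r powi ((i - j)\<^sup>2)) * (a powi (i + j) * b powi (i - j))
        = ((r\<^sup>2) powi (i\<^sup>2) * (r\<^sup>2) powi (j\<^sup>2)) * ((a * b) powi i * (a / b) powi j)"
        by (simp only:)
      thus "r powi (i + j)\<^sup>2 * a powi (i + j) * (r powi (i - j)\<^sup>2 * b powi (i - j)) =
           (r\<^sup>2) powi (i\<^sup>2) * (a * b) powi i * ((r\<^sup>2) powi (j\<^sup>2) * (a / b) powi j)"
        by (simp only: ac_simps)
    qed
    show ?thesis unfolding eq
      using assms r2 by (intro has_sum_jacobi_theta_mult) auto
  qed
  hence 1: "(?F has_sum (jacobi_theta (r\<^sup>2) (a * b) * jacobi_theta (r\<^sup>2) (a / b))) (range \<phi>)"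
    using has_sum_reindex[OF inj(1)] by blast
  have "(?F \<circ> \<psi> has_sum (a * r * (jacobi_theta (r\<^sup>2) (r\<^sup>2 * (a * b)) * jacobi_theta (r\<^sup>2) (r\<^sup>2 * (a / b))))) UNIV"
  proof -
    have eq: "(?F \<circ> \<psi>) = (\<lambda>x. a * r * (\<lambda>(i, j). ((r\<^sup>2) powi (i\<^sup>2) * (r\<^sup>2 * (a * b)) powi i) * ((r\<^sup>2) powi (j\<^sup>2) * (r\<^sup>2 * (a / b)) powi j)) x)"
    proof (intro ext, clarify, unfold o_def \<psi>_def prod.case)
      fix i j :: int
      have "r powi ((i + j + 1)\<^sup>2) * r powi ((i - j)\<^sup>2) = r powi 1 * (((r\<^sup>2) powi (i\<^sup>2) * (r\<^sup>2) powi i) * ((r\<^sup>2) powi (j\<^sup>2) * (r\<^sup>2) powi j))"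
        using assms unfolding power_int_power power_int_add[OF disjI1[OF assms(2)], symmetric]
        by (simp add: power2_eq_square algebra_simps)
      moreover have "a powi (i + j + 1) * b powi (i - j) = a * ((a * b) powi i * (a / b) powi j)"
        using assms by (simp add: power_int_add power_int_diff power_int_mult_distrib power_int_divide_distrib)
      ultimately have "(r powi ((i + j + 1)\<^sup>2) * r powi ((i - j)\<^sup>2)) * (a powi (i + j + 1) * b powi (i - j))
        = (r * (((r\<^sup>2) powi (i\<^sup>2) * (r\<^sup>2) powi i) * ((r\<^sup>2) powi (j\<^sup>2) * (r\<^sup>2) powi j))) * (a * ((a * b) powi i * (a / b) powi j))"
        by simp
      thus "r powi (i + j + 1)\<^sup>2 * a powi (i + j + 1) * (r powi (i - j)\<^sup>2 * b powi (i - j)) =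
           a * r * ((r\<^sup>2) powi (i\<^sup>2) * (r\<^sup>2 * (a * b)) powi i * ((r\<^sup>2) powi (j\<^sup>2) * (r\<^sup>2 * (a / b)) powi j))"
        unfolding power_int_mult_distrib[of "r\<^sup>2"] by (simp only: ac_simps)
    qed
    show ?thesis unfolding eq
      using assms r2 by (intro has_sum_cmult_right has_sum_jacobi_theta_mult) auto
  qed
  hence 2: "(?F has_sum (a * r * (jacobi_theta (r\<^sup>2) (r\<^sup>2 * (a * b)) * jacobi_theta (r\<^sup>2) (r\<^sup>2 * (a / b))))) (range \<psi>)"
    using has_sum_reindex[OF inj(2)] by blast
  have "(?F has_sum (jacobi_theta r a * jacobi_theta r b)) UNIV"
    using assms by (intro has_sum_jacobi_theta_mult) auto
  from has_sum_unique[OF this has_sum_Un_disjoint[OF 1 2 disj, unfolded un]]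
  show ?thesis by (simp add: mult.assoc)
qed

text \<open>The quintuple product identity, multiplied by
  \<open>jacobi_theta (r ^ 6) (- r\<^sup>2)\<close>. The double sum for the left side is split by
  the residue \<open>e\<close> of \<open>m + 2 * n\<close> modulo 3; each class factors into a theta
  series of nome \<open>r ^ 3\<close> and one of nome \<open>r ^ 6\<close>.\<close>

lemma quintuple_product:
  fixes r z :: complex
  assumes "norm r < 1" "r \<noteq> 0" "z \<noteq> 0"
  shows "jacobi_theta r (- z / r) * jacobi_theta (r\<^sup>2) (- z\<^sup>2) =
    jacobi_theta (r ^ 6) (- r\<^sup>2) * (jacobi_theta (r ^ 3) (z ^ 3 / r) - z * jacobi_theta (r ^ 3) (z ^ 3 * r))"
proof -
  let ?F = "\<lambda>(m::int, n::int). (r powi (m\<^sup>2) * (- z / r) powi m) * ((r\<^sup>2) powi (n\<^sup>2) * (- z\<^sup>2) powi n)"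
  have rn: "norm (r ^ n) < 1" if "n > 0" for n
    using assms that by (simp add: norm_power power_less_one_iff)
  \<comment> \<open>These coordinates, with \<open>m + 2 n = 3 j + e\<close>, diagonalise the quadratic form \<open>m\<^sup>2 + 2 n\<^sup>2\<close>.\<close>
  define \<phi> where "\<phi> e = (\<lambda>(j::int, l::int). (j - 2 * l + e, l + j))" for e :: int
  have inj: "inj (\<phi> e)" for e
    by (auto simp: inj_on_def \<phi>_def)
  have mod3: "(m + 2 * n) mod 3 = e" if mn: "(m, n) \<in> range (\<phi> e)" and e: "e \<in> {0, 1, 2}" for m n e
  proof -
    obtain x where "(m, n) = \<phi> e x"
      using mn by blast
    hence "m + 2 * n = e + 3 * fst x"
      by (cases x) (simp add: \<phi>_def)
    hence "(m + 2 * n) mod 3 = e mod 3"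
      by simp
    also have "\<dots> = e" using e by auto
    finally show ?thesis .
  qed
  have "range (\<phi> e) \<inter> range (\<phi> e') = {}" if ee': "e \<noteq> e'" "e \<in> {0, 1, 2}" "e' \<in> {0, 1, 2}" for e e'
  proof -
    have False if "x \<in> range (\<phi> e)" "x \<in> range (\<phi> e')" for x
      using that ee' mod3[of "fst x" "snd x" e] mod3[of "fst x" "snd x" e'] by (simp only: prod.collapse)
    thus ?thesis by blast
  qed
  from this[of 0 1] this[of 0 2] this[of 1 2]
  have disj: "range (\<phi> 0) \<inter> range (\<phi> 1) = {}" "(range (\<phi> 0) \<union> range (\<phi> 1)) \<inter> range (\<phi> 2) = {}"
    by (simp_all add: Int_Un_distrib2)
  have un: "range (\<phi> 0) \<union> range (\<phi> 1) \<union> range (\<phi> 2) = UNIV"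
  proof -
    have "(m, n) \<in> range (\<phi> 0) \<union> range (\<phi> 1) \<union> range (\<phi> 2)" for m n
    proof -
      define j e where "j = (m + 2 * n) div 3" and "e = (m + 2 * n) mod 3"
      have "m + 2 * n = 3 * j + e"
        by (simp add: j_def e_def)
      hence "(m, n) = \<phi> e (j, n - j)"
        by (simp add: \<phi>_def)
      moreover have "e \<in> {0, 1, 2}" by (auto simp: e_def)
      ultimately show ?thesis by (metis UnI1 UnI2 insertE rangeI singletonD)
    qed
    thus ?thesis by auto
  qed
  have F\<phi>: "((?F \<circ> \<phi> e) has_sum ((-1) powi e * z powi e * r powi (e\<^sup>2 - e) *
        (jacobi_theta (r ^ 3) (z ^ 3 * r powi (2 * e - 1)) * jacobi_theta (r ^ 6) (- (r powi (2 - 4 * e)))))) UNIV" for e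
  proof -
    have eq: "(?F \<circ> \<phi> e) = (\<lambda>x. (-1) powi e * z powi e * r powi (e\<^sup>2 - e) *
       (\<lambda>(j, l). ((r ^ 3) powi (j\<^sup>2) * (z ^ 3 * r powi (2 * e - 1)) powi j) * ((r ^ 6) powi (l\<^sup>2) * (- (r powi (2 - 4 * e))) powi l)) x)"
    proof (intro ext, clarify, unfold o_def \<phi>_def prod.case)
      fix j l :: int
      define m n where "m = j - 2 * l + e" and "n = l + j"
      have neg: "(- x) powi k = (-1) powi k * x powi k" for x :: complex and k
        using power_int_mult_distrib[of "-1" x k] by simp
      have Z: "z powi m * (z\<^sup>2) powi n = z powi e * (z ^ 3) powi j"
        using assms unfolding power_int_power power_int_add[OF disjI1[OF assms(3)], symmetric]
        by (simp add: m_def n_def algebra_simps)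
      have R: "r powi (m\<^sup>2) * r powi (- m) * (r\<^sup>2) powi (n\<^sup>2) = r powi (e\<^sup>2 - e) *
          ((r ^ 3) powi (j\<^sup>2) * (r powi (2 * e - 1)) powi j) * ((r ^ 6) powi (l\<^sup>2) * (r powi (2 - 4 * e)) powi l)"
        using assms unfolding power_int_power power_int_mult[symmetric] power_int_add[OF disjI1[OF assms(2)], symmetric]
        by (intro arg_cong[where f = "power_int r"]) (simp add: m_def n_def power2_eq_square algebra_simps)
      have S: "(-1) powi m * (-1) powi n = (-1) powi e * (-1 :: complex) powi l"
      proof -
        have mn: "m + n = e + l + 2 * (j - l)"
          by (simp add: m_def n_def)
        have "(-1) powi m * (-1) powi n = (-1 :: complex) powi (m + n)"
          by (rule power_int_add[symmetric]) simp
        also have "\<dots> = (-1) powi e * (-1) powi l * ((-1) powi 2) powi (j - l)"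
          unfolding mn power_int_mult[symmetric] by (subst power_int_add, simp)+ (rule refl)
        finally show ?thesis by simp
      qed
      have zm: "(- z / r) powi m = (-1) powi m * z powi m * r powi (- m)"
        by (simp only: power_int_divide_distrib neg[of z] power_int_minus_divide) simp
      have zn: "(- z\<^sup>2) powi n = (-1) powi n * (z\<^sup>2) powi n"
        by (rule neg)
      have rl: "(- (r powi (2 - 4 * e))) powi l = (-1) powi l * (r powi (2 - 4 * e)) powi l"
        by (rule neg)
      have "(r powi (m\<^sup>2) * (- z / r) powi m) * ((r\<^sup>2) powi (n\<^sup>2) * (- z\<^sup>2) powi n)
        = ((-1) powi m * (-1) powi n) * (z powi m * (z\<^sup>2) powi n) * (r powi (m\<^sup>2) * r powi (- m) * (r\<^sup>2) powi (n\<^sup>2))"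
        unfolding zm zn by (simp only: mult_ac)
      also have "\<dots> = (-1) powi e * z powi e * r powi (e\<^sup>2 - e) *
       ((r ^ 3) powi (j\<^sup>2) * (z ^ 3 * r powi (2 * e - 1)) powi j * ((r ^ 6) powi (l\<^sup>2) * (- (r powi (2 - 4 * e))) powi l))"
        unfolding S Z R rl power_int_mult_distrib[of "z ^ 3"] by (simp only: mult_ac)
      finally show "r powi (j - 2 * l + e)\<^sup>2 * (- z / r) powi (j - 2 * l + e) * ((r\<^sup>2) powi (l + j)\<^sup>2 * (- z\<^sup>2) powi (l + j)) =
        (-1) powi e * z powi e * r powi (e\<^sup>2 - e) *
       ((r ^ 3) powi (j\<^sup>2) * (z ^ 3 * r powi (2 * e - 1)) powi j * ((r ^ 6) powi (l\<^sup>2) * (- (r powi (2 - 4 * e))) powi l))"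
        by (simp only: m_def n_def)
    qed
    show ?thesis unfolding eq
      using assms rn[of 3] rn[of 6] by (intro has_sum_cmult_right has_sum_jacobi_theta_mult) auto
  qed
  have F: "(?F has_sum ((-1) powi e * z powi e * r powi (e\<^sup>2 - e) *
        (jacobi_theta (r ^ 3) (z ^ 3 * r powi (2 * e - 1)) * jacobi_theta (r ^ 6) (- (r powi (2 - 4 * e)))))) (range (\<phi> e))" for e
    using F\<phi>[of e] has_sum_reindex[OF inj[of e]] by blast
  have "(?F has_sum (jacobi_theta r (- z / r) * jacobi_theta (r\<^sup>2) (- z\<^sup>2))) UNIV"
    using assms rn[of 2] by (intro has_sum_jacobi_theta_mult) auto
  note * = has_sum_unique[OF this has_sum_Un_disjoint[OF has_sum_Un_disjoint[OF F[of 0] F[of 1] disj(1)] F[of 2] disj(2), unfolded un]]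
  \<comment> \<open>The class \<open>e = 2\<close> drops out because its second factor sits at the
    zero of theta. The classes 0 and 1 share their second factor by inversion, which leaves a
    two-term difference.\<close>
  have e2: "jacobi_theta (r ^ 6) (- (r powi (2 - 4 * 2))) = 0"
    using jacobi_theta_eq_0[of "r ^ 6"] assms by (simp add: power_int_minus divide_simps)
  have e1: "jacobi_theta (r ^ 6) (- (r powi (2 - 4 * 1))) = jacobi_theta (r ^ 6) (- r\<^sup>2)"
    using jacobi_theta_inverse[of "r ^ 6" "- r\<^sup>2"] by (simp add: power_int_minus divide_simps)
  have e0: "z ^ 3 * r powi (2 * 0 - 1) = z ^ 3 / r" "z ^ 3 * r powi (2 * 1 - 1) = z ^ 3 * r"
    by (simp_all add: power_int_minus divide_inverse)
  show ?thesis
    unfolding * e0 e1 e2 by (simp add: right_diff_distrib mult.commute mult.left_commute)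
qed

text \<open>With D(x,y) = \<open>\<beta> x * \<alpha> y - \<alpha> x * \<beta> y\<close> the claim
  is the Pluecker relation D(x,y) D(u,v) = D(x,u) D(y,v) + D(x,v) D(u,y); the monomial prefactors
  all reduce to \<open>x * u\<close>.\<close>

lemma weierstrass_three_term:
  fixes r x y u v :: complex
  assumes "norm r < 1" "r \<noteq> 0" "x \<noteq> 0" "y \<noteq> 0" "u \<noteq> 0" "v \<noteq> 0"
  defines "\<theta> \<equiv> \<lambda>z. jacobi_theta r (- z / r)"
  shows "\<theta> (x * y) * \<theta> (x / y) * \<theta> (u * v) * \<theta> (u / v) =
    u / y * (\<theta> (x * u) * \<theta> (x / u) * \<theta> (y * v) * \<theta> (y / v))
    + \<theta> (x * v) * \<theta> (x / v) * \<theta> (u * y) * \<theta> (u / y)"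
proof -
  define \<alpha> where "\<alpha> x = jacobi_theta (r\<^sup>2) (x\<^sup>2)" for x
  define \<beta> where "\<beta> x = x * jacobi_theta (r\<^sup>2) (r\<^sup>2 * x\<^sup>2)" for x
  have det: "\<theta> (x * y) * \<theta> (x / y) = x * (\<beta> x * \<alpha> y - \<alpha> x * \<beta> y)" if "x \<noteq> 0" "y \<noteq> 0" for x y
  proof -
    \<comment> \<open>The product formula yields a theta value at
      \<open>x\<^sup>2 / r\<^sup>2\<close>; one shift brings it to \<open>x * \<beta> x\<close>, so
      that only \<open>\<alpha>\<close> and \<open>\<beta>\<close> occur.\<close>
    have "r\<^sup>2 * (x\<^sup>2 / r\<^sup>2) * jacobi_theta (r\<^sup>2) ((r\<^sup>2)\<^sup>2 * (x\<^sup>2 / r\<^sup>2)) = jacobi_theta (r\<^sup>2) (x\<^sup>2 / r\<^sup>2)"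
      using assms that by (intro jacobi_theta_shift) auto
    hence "jacobi_theta (r\<^sup>2) (x\<^sup>2 / r\<^sup>2) = x * \<beta> x"
      using assms by (simp add: \<beta>_def power2_eq_square mult.assoc)
    moreover have "(- (x * y) / r) * (- (x / y) / r) = x\<^sup>2 / r\<^sup>2" "(- (x * y) / r) / (- (x / y) / r) = y\<^sup>2"
      using assms that by (auto simp: power2_eq_square field_simps)
    ultimately show ?thesis
      using jacobi_theta_mult[of r "- (x * y) / r" "- (x / y) / r"] assms that
      by (simp add: \<theta>_def \<alpha>_def \<beta>_def algebra_simps)
  qed
  have "\<theta> (x * y) * \<theta> (x / y) * (\<theta> (u * v) * \<theta> (u / v)) =
    u / y * ((\<theta> (x * u) * \<theta> (x / u)) * (\<theta> (y * v) * \<theta> (y / v)))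
    + (\<theta> (x * v) * \<theta> (x / v)) * (\<theta> (u * y) * \<theta> (u / y))"
    unfolding det[OF assms(3,4)] det[OF assms(5,6)] det[OF assms(3,5)] det[OF assms(4,6)]
      det[OF assms(3,6)] det[OF assms(5,4)]
    using \<open>y \<noteq> 0\<close> by (simp add: field_simps)
  thus ?thesis by (simp only: mult.assoc)
qed

section \<open>The exponent sequence\<close>

text \<open>
  The positive integers \<open>x\<close> with \<open>x\<^sup>2 \<equiv> 49 (mod 240)\<close> are the numbers \<open>120 k + class_root i\<close>, and
  \<open>class_offset i = ((class_root i)\<^sup>2 - 49) / 240\<close>.
\<close>

definition class_root :: "nat \<Rightarrow> nat" where
  "class_root i = [7, 17, 23, 47, 73, 97, 103, 113] ! i"

definition class_offset :: "nat \<Rightarrow> nat" where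
  "class_offset i = [0, 1, 2, 9, 22, 39, 44, 53] ! i"

lemma lt_8_cases:
  assumes "i < (8::nat)"
  obtains "i = 0" | "i = 1" | "i = 2" | "i = 3" | "i = 4" | "i = 5" | "i = 6" | "i = 7"
  using assms by linarith

text \<open>A finite check, with the values 0 and 1 excluded separately.\<close>

lemma square_class_mod_120:
  assumes "t < 120" "t\<^sup>2 mod 240 = (49::nat)"
  shows "\<exists>i<8. t = class_root i"
proof -
  have "\<forall>t\<in>set [2..<120]. t * t mod 240 = 49 \<longrightarrow> t \<in> set [7, 17, 23, 47, 73, 97, 103, 113]"
    by (simp add: upt_rec_numeral del: upt.simps)
  moreover have "t \<noteq> 0" "t \<noteq> 1"
    using assms(2) by (intro notI; simp)+
  hence "t \<in> set [2..<120]"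
    using assms(1) unfolding set_upt by simp
  ultimately have "t * t mod 240 = 49 \<longrightarrow> t \<in> set [7, 17, 23, 47, 73, 97, 103, 113]"
    by (rule bspec)
  hence "t \<in> set [7, 17, 23, 47, 73, 97, 103, 113]"
    using assms(2) unfolding power2_eq_square by (rule mp)
  then obtain i where "i < length [7, 17, 23, 47, 73, 97, 103, 113 :: nat]" "[7, 17, 23, 47, 73, 97, 103, 113] ! i = t"
    unfolding in_set_conv_nth by blast
  thus ?thesis
    by (intro exI[of _ i]) (simp add: class_root_def)
qed

text \<open>If the functions agree below \<open>n\<close>, then \<open>g n = f j\<close> for some
  \<open>j \<ge> n\<close>, hence \<open>f n \<le> g n\<close>; the argument is symmetric.\<close>

lemma strict_mono_range_unique:
  fixes f g :: "nat \<Rightarrow> 'a::linorder"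
  assumes f: "strict_mono f" and g: "strict_mono g" and "range f = range g"
  shows "f = g"
proof
  have le: "f n \<le> g n"
    if eq: "\<And>m. m < n \<Longrightarrow> f m = g m" and rng: "range f = range g" and mono: "strict_mono f" "strict_mono g"
    for f g :: "nat \<Rightarrow> 'a" and n
  proof -
    obtain j where j: "g n = f j"
      using rng by (metis rangeE rangeI)
    have "\<not> j < n"
      using j eq[of j] mono(2) by (metis less_irrefl strict_monoD)
    thus ?thesis
      using j mono(1) by (simp add: strict_mono_less_eq)
  qed
  show "f n = g n" for n
  proof (induction n rule: less_induct)
    case (less n)
    thus ?case
      using le[of n f g] le[of n g f] assms by (simp add: antisym)
  qed
qed

text \<open>The right-hand side, as a function of \<open>8 * k + i\<close>, is strictly increasing
  with range \<open>square_indices\<close>, which determines it. The key identity is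
  \<open>240 * b (8 * k + i) + 49 = (120 * k + class_root i)\<^sup>2\<close>.\<close>

lemma a_seq_explicit:
  assumes "i < 8"
  shows "a_seq (8 * k + i) = 60 * k\<^sup>2 + class_root i * k + class_offset i"
proof -
  define b where "b n = 60 * (n div 8)\<^sup>2 + class_root (n mod 8) * (n div 8) + class_offset (n mod 8)" for n
  have b: "b (8 * k + i) = 60 * k\<^sup>2 + class_root i * k + class_offset i" if "i < 8" for k i
    using that by (simp add: b_def)
  have square: "240 * b (8 * k + i) + 49 = (120 * k + class_root i)\<^sup>2" if "i < 8" for k i
    unfolding b[OF that] using that
    by (cases rule: lt_8_cases) (simp_all add: class_root_def class_offset_def power2_eq_square algebra_simps)
  have decomp: "\<exists>k i. n = 8 * k + i \<and> i < 8" for n :: nat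
    by (intro exI[of _ "n div 8"] exI[of _ "n mod 8"]) simp
  have "b n < b (Suc n)" for n
  proof -
    obtain k i where n: "n = 8 * k + i" "i < 8"
      using decomp by blast
    show ?thesis
    proof (cases "i = 7")
      \<comment> \<open>Crossing to the next block of eight: the comparison is between root 113 at
        \<open>k\<close> and root 7 at \<open>k + 1\<close>.\<close>
      case True
      hence "Suc n = 8 * (k + 1) + 0" using n by simp
      hence "b (Suc n) = 60 * (k + 1)\<^sup>2 + class_root 0 * (k + 1) + class_offset 0"
        using b[of 0 "k + 1"] by simp
      thus ?thesis
        using b[of 7 k] n True by (simp add: class_root_def class_offset_def power2_eq_square algebra_simps)
    next
      case False
      hence "b (Suc n) = 60 * k\<^sup>2 + class_root (Suc i) * k + class_offset (Suc i)"
        using b[of "Suc i" k] n by simp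
      moreover have "class_root i \<le> class_root (Suc i)" "class_offset i < class_offset (Suc i)"
        using n(2) False by (cases rule: lt_8_cases; simp add: class_root_def class_offset_def)+
      ultimately show ?thesis
        using b[of i k] n by (simp add: add_le_less_mono)
    qed
  qed
  hence "strict_mono b"
    by (simp add: strict_mono_Suc_iff)
  moreover have "range b = square_indices"
  proof (intro equalityI subsetI)
    fix m assume "m \<in> range b"
    then obtain n where "m = b n" by blast
    moreover obtain k i where "n = 8 * k + i" "i < 8"
      using decomp by blast
    ultimately have "240 * m + 49 = (120 * k + class_root i)\<^sup>2"
      using square by simp
    thus "m \<in> square_indices"
      unfolding square_indices_def is_nth_power_def by blast
  next
    fix m assume "m \<in> square_indices"
    then obtain x where x: "240 * m + 49 = x\<^sup>2"
      unfolding square_indices_def is_nth_power_def by blast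
    define k t where "k = x div 120" and "t = x mod 120"
    have xkt: "x = 120 * k + t" by (simp add: k_def t_def)
    \<comment> \<open>Residues modulo 120 suffice, since \<open>120\<^sup>2\<close> and the cross
      term \<open>240 * k * t\<close> are multiples of 240.\<close>
    have "x\<^sup>2 = t\<^sup>2 + 240 * (60 * k\<^sup>2 + k * t)"
      unfolding xkt by (simp add: power2_eq_square algebra_simps)
    hence "t\<^sup>2 mod 240 = x\<^sup>2 mod 240" by (metis mod_mult_self2)
    also have "\<dots> = 49" unfolding x[symmetric] by simp
    finally obtain i where i: "i < 8" "t = class_root i"
      using square_class_mod_120[of t] by (auto simp: t_def)
    have "240 * b (8 * k + i) + 49 = 240 * m + 49"
      unfolding square[OF i(1)] x xkt i(2) ..
    hence "m = b (8 * k + i)" by linarith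
    thus "m \<in> range b" by blast
  qed
  ultimately have "a_seq = b"
    using strict_mono_a_seq range_a_seq by (intro strict_mono_range_unique) auto
  thus ?thesis using b[OF assms] by simp
qed

lemma has_sum_residue_classes:
  fixes F :: "nat \<Rightarrow> 'a::topological_comm_monoid_add"
  assumes "d > 0" "\<And>i. i < d \<Longrightarrow> ((\<lambda>k. F (d * k + i)) has_sum s i) UNIV"
  shows "(F has_sum (\<Sum>i<d. s i)) UNIV"
proof -
  have "(F has_sum (\<Sum>i<d. s i)) (\<Union>i\<in>{..<d}. range (\<lambda>k. d * k + i))"
  proof (rule sum_has_sum)
    fix i assume "i \<in> {..<d}"
    thus "(F has_sum s i) (range (\<lambda>k. d * k + i))"
      using assms by (subst has_sum_reindex) (auto simp: inj_on_def o_def)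
  next
    fix i j assume ij: "i \<in> {..<d}" "j \<in> {..<d}" "i \<noteq> j"
    have "n mod d = i" if n: "n \<in> range (\<lambda>k. d * k + i)" and i: "i \<in> {..<d}" for n i
    proof -
      obtain k where "n = d * k + i" using n by blast
      thus ?thesis using i by simp
    qed
    note mod_eq = this
    have False if "n \<in> range (\<lambda>k. d * k + i)" "n \<in> range (\<lambda>k. d * k + j)" for n
      using mod_eq[OF that(1) ij(1)] mod_eq[OF that(2) ij(2)] ij(3) by simp
    thus "range (\<lambda>k. d * k + i) \<inter> range (\<lambda>k. d * k + j) = {}"
      by (intro equals0I) (elim IntE)
  qed simp
  also have "(\<Union>i\<in>{..<d}. range (\<lambda>k. d * k + i)) = UNIV"
  proof (rule set_eqI)
    fix n
    have "n = d * (n div d) + n mod d" "n mod d < d" using assms(1) by simp_all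
    thus "n \<in> (\<Union>i\<in>{..<d}. range (\<lambda>k. d * k + i)) \<longleftrightarrow> n \<in> UNIV" by blast
  qed
  finally show ?thesis .
qed

section \<open>Rearranging the infinite products\<close>

text \<open>Group the factors by their index modulo \<open>k\<close>; for partial products of length
  \<open>n * k\<close> this is a finite rearrangement.\<close>

lemma qpoch_inf_split:
  assumes "norm q < 1" "k > 0"
  shows "qpoch_inf a q = (\<Prod>j<k. qpoch_inf (a * q ^ j) (q ^ k))"
proof -
  have qk: "norm (q ^ k) < 1"
    using assms by (simp add: norm_power power_less_one_iff)
  have add: "(\<Prod>i<m + l. f i) = (\<Prod>i<m. f i) * (\<Prod>i<l. f (m + i))" for f :: "nat \<Rightarrow> complex" and m l
    by (induction l) (simp_all add: mult.assoc)
  have eq: "(\<Prod>i<n * k. 1 - a * q ^ i) = (\<Prod>j<k. \<Prod>i<n. 1 - (a * q ^ j) * (q ^ k) ^ i)" for n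
  proof (induction n)
    case (Suc n)
    have "(\<Prod>i<Suc n * k. 1 - a * q ^ i) = (\<Prod>i<n * k. 1 - a * q ^ i) * (\<Prod>j<k. 1 - a * q ^ (n * k + j))"
      using add[of _ "n * k" k] by (simp add: add.commute)
    also have "(\<Prod>j<k. 1 - a * q ^ (n * k + j)) = (\<Prod>j<k. 1 - (a * q ^ j) * (q ^ k) ^ n)"
      by (intro prod.cong) (auto simp: power_add power_mult mult_ac simp flip: power_mult)
    finally show ?case
      using Suc by (simp add: prod.distrib)
  qed simp
  have "(\<lambda>n. \<Prod>i<n * k. 1 - a * q ^ i) \<longlonglongrightarrow> qpoch_inf a q"
    by (rule filterlim_compose[OF qpoch_inf_LIMSEQ[OF assms(1)] mult_nat_right_at_top[OF assms(2)]])
  moreover have "(\<lambda>n. \<Prod>i<n * k. 1 - a * q ^ i) \<longlonglongrightarrow> (\<Prod>j<k. qpoch_inf (a * q ^ j) (q ^ k))"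
    unfolding eq by (intro tendsto_prod qpoch_inf_LIMSEQ qk)
  ultimately show ?thesis
    by (rule LIMSEQ_unique)
qed

lemma qpoch_inf_power_split:
  assumes "norm q < 1" "n > 0" "k > 0"
  shows "qpoch_inf (q ^ m) (q ^ n) = (\<Prod>j<k. qpoch_inf (q ^ (m + n * j)) (q ^ (n * k)))"
  using qpoch_inf_split[of "q ^ n" k "q ^ m"] assms
  by (simp add: norm_power power_less_one_iff power_add power_mult)

lemma qpoch_inf_mult_neg:
  assumes "norm q < 1"
  shows "qpoch_inf a q * qpoch_inf (- a) q = qpoch_inf (a\<^sup>2) (q\<^sup>2)"
proof (rule LIMSEQ_unique)
  have q2: "norm (q\<^sup>2) < 1"
    using assms by (simp add: norm_power power_less_one_iff)
  show "(\<lambda>n. \<Prod>i<n. 1 - a\<^sup>2 * (q\<^sup>2) ^ i) \<longlonglongrightarrow> qpoch_inf (a\<^sup>2) (q\<^sup>2)"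
    by (rule qpoch_inf_LIMSEQ[OF q2])
  have "(1 - a * q ^ i) * (1 - (- a) * q ^ i) = 1 - a\<^sup>2 * (q\<^sup>2) ^ i" for i
    by (simp add: power2_eq_square power_mult_distrib algebra_simps)
  hence "(\<Prod>i<n. 1 - a\<^sup>2 * (q\<^sup>2) ^ i) = (\<Prod>i<n. 1 - a * q ^ i) * (\<Prod>i<n. 1 - (- a) * q ^ i)" for n
    by (simp only: prod.distrib[symmetric])
  thus "(\<lambda>n. \<Prod>i<n. 1 - a\<^sup>2 * (q\<^sup>2) ^ i) \<longlonglongrightarrow> qpoch_inf a q * qpoch_inf (- a) q"
    by (simp only:) (intro tendsto_mult qpoch_inf_LIMSEQ assms)
qed

text \<open>The triple product at \<open>w = - z / r\<close>, in the normalisation of the overview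
  with \<open>p = r\<^sup>2\<close>.\<close>

lemma jacobi_theta_eq_qpoch:
  fixes r z :: complex
  assumes "norm r < 1" "r \<noteq> 0" "z \<noteq> 0"
  shows "jacobi_theta r (- z / r) = qpoch_inf (r\<^sup>2) (r\<^sup>2) * qpoch_inf z (r\<^sup>2) * qpoch_inf (r\<^sup>2 / z) (r\<^sup>2)"
  using jacobi_triple_product[of r "- z / r"] assms by (simp add: power2_eq_square)

section \<open>The series as a combination of four theta series\<close>

text \<open>Nonnegative indices give the first sum, \<open>n = - (k + 1)\<close> the second. The
  linear coefficients \<open>c\<close> and \<open>120 - c\<close> are thus two roots of opposite
  sign modulo 120 sharing one theta series.\<close>

lemma jacobi_theta_half_sums:
  fixes q :: complex
  assumes "norm q < 1" "q \<noteq> 0" "c \<le> 60"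
  obtains s s' where
    "((\<lambda>k. q ^ (60 * k\<^sup>2 + c * k)) has_sum s) UNIV"
    "((\<lambda>k. q ^ (60 * k\<^sup>2 + (120 - c) * k + (60 - c))) has_sum s') UNIV"
    "jacobi_theta (q ^ 60) (q ^ c) = s + s'"
proof -
  let ?g = "\<lambda>n::int. (q ^ 60) powi (n\<^sup>2) * (q ^ c) powi n"
  let ?A = "range int" and ?B = "range (\<lambda>k. - int (Suc k))"
  have sm: "?g summable_on UNIV"
    using assms by (intro summable_jacobi_theta) (auto simp: norm_power power_less_one_iff)
  have sA: "(?g has_sum infsum ?g ?A) ?A" and sB: "(?g has_sum infsum ?g ?B) ?B"
    using summable_on_subset_banach[OF sm] by (auto intro!: has_sum_infsum)
  have "(UNIV::int set) = ?A \<union> ?B"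
  proof (intro equalityI subsetI)
    fix n :: int
    show "n \<in> ?A \<union> ?B" by (cases n) auto
  qed simp
  moreover have "?A \<inter> ?B = {}" by auto
  ultimately have "jacobi_theta (q ^ 60) (q ^ c) = infsum ?g ?A + infsum ?g ?B"
    unfolding jacobi_theta_def using has_sum_Un_disjoint[OF sA sB] by (simp add: infsumI)
  moreover have "((?g \<circ> int) has_sum infsum ?g ?A) UNIV"
    using sA has_sum_reindex[of int UNIV ?g] by simp
  moreover have "(?g \<circ> int) = (\<lambda>k. q ^ (60 * k\<^sup>2 + c * k))"
    by (auto simp: fun_eq_iff power_add power_mult simp flip: of_nat_power)
  moreover have "((?g \<circ> (\<lambda>k. - int (Suc k))) has_sum infsum ?g ?B) UNIV"
    using sB has_sum_reindex[of "\<lambda>k. - int (Suc k)" UNIV ?g] by (simp add: inj_on_def)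
  moreover have "(?g \<circ> (\<lambda>k. - int (Suc k))) = (\<lambda>k. q ^ (60 * k\<^sup>2 + (120 - c) * k + (60 - c)))"
  proof
    fix k
    obtain d where d: "60 = c + d" using assms(3) le_Suc_ex by blast
    have d': "60 - c = d" "120 - c = 60 + d" using d by simp_all
    have "60 * (Suc k)\<^sup>2 = (60 * k\<^sup>2 + (60 + d) * k + d) + c * Suc k"
    proof -
      have "(60 * k\<^sup>2 + (60 + d) * k + d) + c * Suc k = 60 * k\<^sup>2 + 60 * k + (c + d) * k + (c + d)"
        by (simp add: algebra_simps)
      thus ?thesis unfolding d[symmetric] by (simp add: power2_eq_square)
    qed
    hence "q ^ (60 * (Suc k)\<^sup>2) = q ^ (60 * k\<^sup>2 + (120 - c) * k + (60 - c)) * q ^ (c * Suc k)"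
      unfolding d' by (metis power_add)
    moreover have "(q ^ 60) powi ((- int (Suc k))\<^sup>2) = q ^ (60 * (Suc k)\<^sup>2)"
      unfolding power2_minus by (metis of_nat_power power_int_of_nat power_mult)
    moreover have "(q ^ c) powi (- int (Suc k)) = inverse (q ^ (c * Suc k))"
      unfolding power_int_minus by (metis power_int_of_nat power_mult)
    ultimately show "(?g \<circ> (\<lambda>k. - int (Suc k))) k = q ^ (60 * k\<^sup>2 + (120 - c) * k + (60 - c))"
      using assms(2) by simp
  qed
  ultimately show ?thesis
    by (intro that[of "infsum ?g ?A" "infsum ?g ?B"]) (simp_all only:)
qed

text \<open>The sign depends only on the residue of \<open>n\<close> modulo 8, being +, -, +, -, -,
  +, -, + there. It agrees for \<open>i\<close> and \<open>7 - i\<close>, whose roots add up to 120,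
  so the eight classes combine in pairs into theta series.\<close>

lemma has_sum_a_seq:
  fixes q :: complex
  assumes "norm q < 1" "q \<noteq> 0"
  shows "((\<lambda>n. (-1) ^ nat \<lfloor>5 * real n / 4\<rfloor> * q ^ a_seq n) has_sum
    (jacobi_theta (q ^ 60) (q ^ 7) - q * jacobi_theta (q ^ 60) (q ^ 17)
      + q\<^sup>2 * jacobi_theta (q ^ 60) (q ^ 23) - q ^ 9 * jacobi_theta (q ^ 60) (q ^ 47))) UNIV"
proof -
  let ?F = "\<lambda>n. (-1) ^ nat \<lfloor>5 * real n / 4\<rfloor> * q ^ a_seq n"
  have F: "?F (8 * k + i) = (-1) ^ (5 * i div 4) * q ^ class_offset i * q ^ (60 * k\<^sup>2 + class_root i * k)"
    if "i < 8" for k i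
  proof -
    have "nat \<lfloor>5 * real n / 4\<rfloor> = 5 * n div 4" for n
      using floor_divide_of_nat_eq[of "5 * n" 4, where 'a = real] by simp
    moreover have "5 * (8 * k + i) div 4 = 2 * (5 * k) + 5 * i div 4"
      by simp
    ultimately have "nat \<lfloor>5 * real (8 * k + i) / 4\<rfloor> = 2 * (5 * k) + 5 * i div 4"
      by metis
    hence "(-1 :: complex) ^ nat \<lfloor>5 * real (8 * k + i) / 4\<rfloor> = (-1) ^ (5 * i div 4)"
      by (simp only: power_add power_mult) simp
    thus ?thesis
      unfolding a_seq_explicit[OF that] by (simp add: power_add)
  qed
  obtain s7 t7 where 7: "((\<lambda>k. q ^ (60 * k\<^sup>2 + 7 * k)) has_sum s7) UNIV"
    "((\<lambda>k. q ^ (60 * k\<^sup>2 + (120 - 7) * k + (60 - 7))) has_sum t7) UNIV" "jacobi_theta (q ^ 60) (q ^ 7) = s7 + t7"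
    using jacobi_theta_half_sums[OF assms, of 7] by auto
  obtain s17 t17 where 17: "((\<lambda>k. q ^ (60 * k\<^sup>2 + 17 * k)) has_sum s17) UNIV"
    "((\<lambda>k. q ^ (60 * k\<^sup>2 + (120 - 17) * k + (60 - 17))) has_sum t17) UNIV" "jacobi_theta (q ^ 60) (q ^ 17) = s17 + t17"
    using jacobi_theta_half_sums[OF assms, of 17] by auto
  obtain s23 t23 where 23: "((\<lambda>k. q ^ (60 * k\<^sup>2 + 23 * k)) has_sum s23) UNIV"
    "((\<lambda>k. q ^ (60 * k\<^sup>2 + (120 - 23) * k + (60 - 23))) has_sum t23) UNIV" "jacobi_theta (q ^ 60) (q ^ 23) = s23 + t23"
    using jacobi_theta_half_sums[OF assms, of 23] by auto
  obtain s47 t47 where 47: "((\<lambda>k. q ^ (60 * k\<^sup>2 + 47 * k)) has_sum s47) UNIV"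
    "((\<lambda>k. q ^ (60 * k\<^sup>2 + (120 - 47) * k + (60 - 47))) has_sum t47) UNIV" "jacobi_theta (q ^ 60) (q ^ 47) = s47 + t47"
    using jacobi_theta_half_sums[OF assms, of 47] by auto
  \<comment> \<open>Entries \<open>i\<close> and \<open>7 - i\<close> are the two halves of one
    theta series with a common prefactor; for instance \<open>q ^ 22\<close>, the offset of root 73,
    is \<open>q ^ 9 * q ^ (60 - 47)\<close>.\<close>
  define s where "s = (\<lambda>i. [s7, - q * s17, q\<^sup>2 * s23, - (q ^ 9) * s47, - (q ^ 9) * t47, q\<^sup>2 * t23, - q * t17, t7] ! i)"
  have "(?F has_sum (\<Sum>i<8. s i)) UNIV"
  proof (rule has_sum_residue_classes)
    fix i :: nat assume i: "i < 8"
    have "((\<lambda>k. (-1) ^ (5 * i div 4) * q ^ class_offset i * q ^ (60 * k\<^sup>2 + class_root i * k)) has_sum s i) UNIV"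
    proof (cases rule: lt_8_cases[OF i])
      case 1 thus ?thesis using 7(1) by (simp add: s_def class_root_def class_offset_def)
    next
      case 2 thus ?thesis using has_sum_cmult_right[OF 17(1), of "- q"] by (simp add: s_def class_root_def class_offset_def)
    next
      case 3 thus ?thesis using has_sum_cmult_right[OF 23(1), of "q\<^sup>2"] by (simp add: s_def class_root_def class_offset_def)
    next
      case 4 thus ?thesis using has_sum_cmult_right[OF 47(1), of "- (q ^ 9)"] by (simp add: s_def class_root_def class_offset_def)
    next
      case 5 
      have "- (q ^ 9) * q ^ (60 * k\<^sup>2 + (120 - 47) * k + (60 - 47)) = - (q ^ 22) * q ^ (60 * k\<^sup>2 + 73 * k)" for k
        by (simp add: power_add)
      with 5 show ?thesis using has_sum_cmult_right[OF 47(2), of "- (q ^ 9)"] by (simp add: s_def class_root_def class_offset_def)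
    next
      case 6 
      have "q\<^sup>2 * q ^ (60 * k\<^sup>2 + (120 - 23) * k + (60 - 23)) = (q ^ 39) * q ^ (60 * k\<^sup>2 + 97 * k)" for k
        by (simp add: power_add)
      with 6 show ?thesis using has_sum_cmult_right[OF 23(2), of "q\<^sup>2"] by (simp add: s_def class_root_def class_offset_def)
    next
      case 7 
      have "- q * q ^ (60 * k\<^sup>2 + (120 - 17) * k + (60 - 17)) = - (q ^ 44) * q ^ (60 * k\<^sup>2 + 103 * k)" for k
        using power_Suc[of q 43] by (simp add: power_add)
      with 7 show ?thesis using has_sum_cmult_right[OF 17(2), of "- q"] by (simp add: s_def class_root_def class_offset_def)
    next
      case 8 thus ?thesis using \<open>((\<lambda>k. q ^ (60 * k\<^sup>2 + (120 - 7) * k + (60 - 7))) has_sum t7) UNIV\<close>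
        by (simp add: s_def class_root_def class_offset_def power_add mult.commute)
    qed
    thus "((\<lambda>k. ?F (8 * k + i)) has_sum s i) UNIV"
      unfolding F[OF i] .
  qed simp
  also have "(\<Sum>i<8. s i) = jacobi_theta (q ^ 60) (q ^ 7) - q * jacobi_theta (q ^ 60) (q ^ 17)
      + q\<^sup>2 * jacobi_theta (q ^ 60) (q ^ 23) - q ^ 9 * jacobi_theta (q ^ 60) (q ^ 47)"
    unfolding 7(3) 17(3) 23(3) 47(3)
    by (simp add: s_def lessThan_nat_numeral algebra_simps)
  finally show ?thesis .
qed

section \<open>From the theta combination to the product side\<close>

text \<open>A case of the three-term relation with nome \<open>q ^ 20\<close>, written in factors:
  \<theta> at \<open>q ^ k\<close> is \<open>E * (a k * a (40 - k))\<close>, and at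
  \<open>- (q ^ k)\<close> the same with \<open>b\<close>.\<close>

lemma theta_base_40_relation:
  fixes q :: complex
  assumes "norm q < 1" "q \<noteq> 0"
  defines "a \<equiv> \<lambda>k. qpoch_inf (q ^ k) (q ^ 40)" and "b \<equiv> \<lambda>k. qpoch_inf (- (q ^ k)) (q ^ 40)"
  shows "a 12 * a 28 * b 15 * b 25 * (a 18 * a 22 * b 1 * b 39 - q * (a 2 * a 38 * b 9 * b 31))
    = a 10 * a 30 * a 16 * a 24 * b 3 * b 37 * b 13 * b 27"
proof -
  define r where "r = q ^ 20"
  define \<theta> where "\<theta> = (\<lambda>z. jacobi_theta r (- z / r))"
  define E where "E = qpoch_inf (q ^ 40) (q ^ 40)"
  have r: "norm r < 1" "r \<noteq> 0" "r\<^sup>2 = q ^ 40"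
    using assms(1,2) by (auto simp: r_def norm_power power_less_one_iff)
  have E: "E \<noteq> 0"
    unfolding E_def using assms(1) by (intro qpoch_inf_nonzero) (auto simp: norm_power power_less_one_iff)
  have th: "\<theta> z = E * qpoch_inf z (q ^ 40) * qpoch_inf (q ^ 40 / z) (q ^ 40)" if "z \<noteq> 0" for z
    unfolding \<theta>_def E_def using jacobi_theta_eq_qpoch[OF r(1,2) that] by (simp add: r(3))
  have div: "q ^ 40 / q ^ k = q ^ (40 - k)" if "k \<le> 40" for k
    using that assms(2) by (simp add: power_diff)
  have tha: "\<theta> (q ^ k) = E * (a k * a (40 - k))" if "k \<le> 40" for k
    using th[of "q ^ k"] assms(2) that by (simp add: div a_def)
  have thb: "\<theta> (- (q ^ k)) = E * (b k * b (40 - k))" if "k \<le> 40" for k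
    using th[of "- (q ^ k)"] assms(2) that by (simp add: div b_def)
  have th_inv: "\<theta> (1 / z) = - \<theta> z / z" if "z \<noteq> 0" for z
  proof -
    have "r * (- z / r) * jacobi_theta r (r\<^sup>2 * (- z / r)) = \<theta> z"
      unfolding \<theta>_def using r that by (intro jacobi_theta_shift) auto
    hence "- z * jacobi_theta r (- z * r) = \<theta> z"
      using r(2) by (simp add: power2_eq_square mult.commute)
    moreover have "\<theta> (1 / z) = jacobi_theta r (1 / (- z * r))"
      unfolding \<theta>_def by (simp add: mult.commute)
    ultimately have "\<theta> z = - z * \<theta> (1 / z)"
      by (simp only: jacobi_theta_inverse)
    thus ?thesis using that by simp
  qed
  \<comment> \<open>Chosen so that the first two of the three products share \<theta> at
    \<open>q ^ 12\<close> and at \<open>- (q ^ 15)\<close>: exponents 15 and 25 give the same value,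
    and \<open>1 / q ^ 12\<close> is inverted by \<open>th_inv\<close>. The prefactor
    \<open>- (q ^ 13)\<close> then becomes \<open>q\<close>.\<close>
  let ?x = "q ^ 17" and ?y = "1 / q ^ 5" and ?u = "- (q ^ 8)" and ?v = "q ^ 7"
  have args: "?x * ?y = q ^ 12" "?x / ?y = q ^ 22" "?u * ?v = - (q ^ 15)" "?u / ?v = - (q ^ 1)"
    "?x * ?u = - (q ^ 25)" "?x / ?u = - (q ^ 9)" "?y * ?v = q ^ 2" "?y / ?v = 1 / q ^ 12"
    "?x * ?v = q ^ 24" "?x / ?v = q ^ 10" "?u * ?y = - (q ^ 3)" "?u / ?y = - (q ^ 13)"
    using assms(2) by (auto simp: divide_simps) (simp flip: power_Suc)
  have "\<theta> (?x * ?y) * \<theta> (?x / ?y) * \<theta> (?u * ?v) * \<theta> (?u / ?v) =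
    ?u / ?y * (\<theta> (?x * ?u) * \<theta> (?x / ?u) * \<theta> (?y * ?v) * \<theta> (?y / ?v))
    + \<theta> (?x * ?v) * \<theta> (?x / ?v) * \<theta> (?u * ?y) * \<theta> (?u / ?y)"
    unfolding \<theta>_def using assms(2) r by (intro weierstrass_three_term) auto
  hence "\<theta> (q ^ 12) * \<theta> (q ^ 22) * \<theta> (- (q ^ 15)) * \<theta> (- (q ^ 1)) =
    - (q ^ 13) * (\<theta> (- (q ^ 25)) * \<theta> (- (q ^ 9)) * \<theta> (q\<^sup>2) * (- \<theta> (q ^ 12) / q ^ 12))
    + \<theta> (q ^ 24) * \<theta> (q ^ 10) * \<theta> (- (q ^ 3)) * \<theta> (- (q ^ 13))"
    unfolding args using th_inv[of "q ^ 12"] assms(2) by simp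
  also have "- (q ^ 13) * (\<theta> (- (q ^ 25)) * \<theta> (- (q ^ 9)) * \<theta> (q\<^sup>2) * (- \<theta> (q ^ 12) / q ^ 12))
      = q * (\<theta> (- (q ^ 25)) * \<theta> (- (q ^ 9)) * \<theta> (q\<^sup>2) * \<theta> (q ^ 12))"
    using assms(2) power_Suc[of q 12] by simp
  finally have "E ^ 4 * (a 12 * a 28 * b 15 * b 25 * (a 18 * a 22 * b 1 * b 39 - q * (a 2 * a 38 * b 9 * b 31)))
    = E ^ 4 * (a 10 * a 30 * a 16 * a 24 * b 3 * b 37 * b 13 * b 27)"
    using thb[of 1] by (simp add: tha thb algebra_simps power4_eq_xxxx)
  thus ?thesis using E by simp
qed

text \<open>The quintuple product with \<open>r = q ^ 20\<close> at \<open>z = q ^ 9\<close>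
  evaluates the terms with 7 and 47, and at \<open>z = q\<close> those with 17 and 23.\<close>

lemma jacobi_theta_sum_eq_quintuple_difference:
  fixes q :: complex
  assumes "norm q < 1" "q \<noteq> 0"
  defines "a \<equiv> \<lambda>k. qpoch_inf (q ^ k) (q ^ 40)" and "P \<equiv> \<lambda>k. qpoch_inf (q ^ k) (q ^ 80)"
  shows "jacobi_theta (q ^ 60) (q ^ 7) - q * jacobi_theta (q ^ 60) (q ^ 17)
      + q\<^sup>2 * jacobi_theta (q ^ 60) (q ^ 23) - q ^ 9 * jacobi_theta (q ^ 60) (q ^ 47)
    = a 40 * (a 9 * a 31 * P 58 * P 22 - q * (a 1 * a 39 * P 42 * P 38))"
proof -
  have lt: "norm (q ^ k) < 1" if "k > 0" for k
    using assms(1) that by (simp add: norm_power power_less_one_iff)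
  have P0: "P 80 \<noteq> 0"
    unfolding P_def by (intro qpoch_inf_nonzero lt) simp_all
  \<comment> \<open>The constant factor of the quintuple product; it also occurs in the triple
    product for nome \<open>q ^ 40\<close> and cancels.\<close>
  have base: "jacobi_theta (q ^ 120) (- (q ^ 40)) = P 80"
  proof -
    have "P 80 = (\<Prod>j<3. qpoch_inf (q ^ (80 + 80 * j)) (q ^ (80 * 3)))"
      unfolding P_def using assms(1) by (intro qpoch_inf_power_split) auto
    also have "\<dots> = qpoch_inf (q ^ 240) (q ^ 240) * qpoch_inf (q ^ 160) (q ^ 240) * qpoch_inf (q ^ 80) (q ^ 240)"
      by (simp add: lessThan_nat_numeral lessThan_Suc mult_ac)
    also have "q ^ 120 / q ^ 40 = q ^ 80"
      using assms(2) by (simp add: divide_simps)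
    hence "qpoch_inf (q ^ 240) (q ^ 240) * qpoch_inf (q ^ 160) (q ^ 240) * qpoch_inf (q ^ 80) (q ^ 240) = jacobi_theta (q ^ 120) (- (q ^ 40))"
      using jacobi_triple_product[OF lt[of 120], of "- (q ^ 40)"] assms(2) by simp
    finally show ?thesis ..
  qed
  have quint: "a 40 * (a k * a (40 - k)) * (P (40 + 2 * k) * P (40 - 2 * k))
      = jacobi_theta (q ^ 60) (q ^ (3 * k) / q ^ 20) - q ^ k * jacobi_theta (q ^ 60) (q ^ (3 * k + 20))"
    if k: "k \<le> 20" for k
  proof -
    have d: "q ^ 40 / q ^ k = q ^ (40 - k)" "q ^ 40 / q ^ (2 * k) = q ^ (40 - 2 * k)"
      using k assms(2) by (simp_all add: power_diff)
    have "jacobi_theta (q ^ 20) (- (q ^ k) / q ^ 20) = a 40 * (a k * a (40 - k))"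
      using jacobi_theta_eq_qpoch[OF lt[of 20], of "q ^ k"] assms(2) d by (simp add: a_def)
    moreover have "jacobi_theta ((q ^ 20)\<^sup>2) (- (q ^ k)\<^sup>2) = P 80 * (P (40 + 2 * k) * P (40 - 2 * k))"
      using jacobi_triple_product[OF lt[of 40], of "- (q ^ (2 * k))"] assms(2) d
      by (simp add: P_def power_add mult.commute flip: power_mult)
    ultimately have "a 40 * (a k * a (40 - k)) * (P 80 * (P (40 + 2 * k) * P (40 - 2 * k)))
      = P 80 * (jacobi_theta (q ^ 60) (q ^ (3 * k) / q ^ 20) - q ^ k * jacobi_theta (q ^ 60) (q ^ (3 * k + 20)))"
      using quintuple_product[OF lt[of 20], of "q ^ k"] assms(2) base
      by (simp add: power_add mult.commute flip: power_mult)
    thus ?thesis using P0 by (simp add: mult_ac)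
  qed
  \<comment> \<open>For \<open>k = 1\<close> the argument is \<open>1 / q ^ 17\<close>, which
    inversion turns into \<open>q ^ 17\<close>.\<close>
  have "q ^ 27 / q ^ 20 = q ^ 7" "q ^ 3 / q ^ 20 = 1 / q ^ 17"
    using assms(2) by (simp_all add: divide_simps)
  hence "jacobi_theta (q ^ 60) (q ^ 7) = a 40 * (a 9 * a 31 * P 58 * P 22) + q ^ 9 * jacobi_theta (q ^ 60) (q ^ 47)"
    and "jacobi_theta (q ^ 60) (q ^ 17) = a 40 * (a 1 * a 39 * P 42 * P 38) + q * jacobi_theta (q ^ 60) (q ^ 23)"
    using quint[of 9] quint[of 1] by (simp_all add: jacobi_theta_inverse mult.assoc)
  thus ?thesis
    by (simp add: algebra_simps power2_eq_square)
qed

text \<open>Everything is split into factors of base \<open>q ^ 40\<close> or \<open>q ^ 80\<close>.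
  The three-term relation gives \<open>S * X = Y\<close>, and counting factors gives
  \<open>Y * D = N * X\<close>; cancelling the nonzero \<open>X\<close> leaves
  \<open>S * D = N\<close>.\<close>

lemma quintuple_difference_eq_quotient:
  fixes q :: complex
  assumes "norm q < 1" "q \<noteq> 0"
  defines "a \<equiv> \<lambda>k. qpoch_inf (q ^ k) (q ^ 40)" and "P \<equiv> \<lambda>k. qpoch_inf (q ^ k) (q ^ 80)"
  shows "a 40 * (a 9 * a 31 * P 58 * P 22 - q * (a 1 * a 39 * P 42 * P 38))
    = qpochs_inf [q, q ^ 7, q ^ 8] (q ^ 8) * qpochs_inf [q ^ 6, q ^ 10] (q ^ 16)
      / qpochs_inf [q ^ 2, q ^ 3] (q ^ 5)"
proof -
  define b where "b = (\<lambda>k. qpoch_inf (- (q ^ k)) (q ^ 40))"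
  have lt: "norm (q ^ k) < 1" if "k > 0" for k
    using assms(1) that by (simp add: norm_power power_less_one_iff)
  have a0: "a k \<noteq> 0" if "k > 0" for k
    unfolding a_def using that by (intro qpoch_inf_nonzero lt) simp_all
  have b0: "b k \<noteq> 0" if "k > 0" for k
    unfolding b_def using that lt by (intro qpoch_inf_nonzero) (simp_all del: norm_power)
  have ab: "b k * a k = P (2 * k)" for k
    using qpoch_inf_mult_neg[OF lt[of 40], of "q ^ k"]
    by (simp add: a_def b_def P_def mult.commute flip: power_mult)
  have aP: "a k = P k * P (k + 40)" for k
    using qpoch_inf_power_split[OF assms(1), of 40 2 k]
    by (simp add: a_def P_def lessThan_nat_numeral lessThan_Suc mult.commute)
  define N where "N = qpochs_inf [q, q ^ 7, q ^ 8] (q ^ 8) * qpochs_inf [q ^ 6, q ^ 10] (q ^ 16)"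
  define D where "D = qpochs_inf [q ^ 2, q ^ 3] (q ^ 5)"
  have D0: "D \<noteq> 0"
    using qpoch_inf_nonzero[OF lt[of 5] lt[of 2]] qpoch_inf_nonzero[OF lt[of 5] lt[of 3]]
    by (simp add: D_def qpochs_inf_def)
  have prod8: "(\<Prod>j<8. f j) = f 0 * f 1 * f 2 * f 3 * f 4 * f 5 * f 6 * f 7" for f :: "nat \<Rightarrow> complex"
    by (simp add: eval_nat_numeral)
  have prod5: "(\<Prod>j<5. f j) = f 0 * f 1 * f 2 * f 3 * f 4" for f :: "nat \<Rightarrow> complex"
    by (simp add: eval_nat_numeral)
  have "qpoch_inf (q ^ m) (q ^ 5) = (\<Prod>j<8. a (m + 5 * j))" for m
    unfolding a_def by (subst qpoch_inf_power_split[OF assms(1), of 5 8]) simp_all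
  hence D: "D = (a 2 * a 7 * a 12 * a 17 * a 22 * a 27 * a 32 * a 37) * (a 3 * a 8 * a 13 * a 18 * a 23 * a 28 * a 33 * a 38)"
    unfolding prod8 by (simp add: D_def qpochs_inf_def)
  have q8: "qpoch_inf (q ^ m) (q ^ 8) = (\<Prod>j<5. a (m + 8 * j))" for m
    unfolding a_def by (subst qpoch_inf_power_split[OF assms(1), of 8 5]) simp_all
  have q16: "qpoch_inf (q ^ m) (q ^ 16) = (\<Prod>j<5. P (m + 16 * j))" for m
    unfolding P_def by (subst qpoch_inf_power_split[OF assms(1), of 16 5]) simp_all
  have N: "N = (a 1 * a 9 * a 17 * a 25 * a 33) * (a 7 * a 15 * a 23 * a 31 * a 39) * (a 8 * a 16 * a 24 * a 32 * a 40)
      * (P 6 * P 22 * P 38 * P 54 * P 70) * (P 10 * P 26 * P 42 * P 58 * P 74)"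
    using q8[of 1] q8[of 7] q8[of 8] q16[of 6] q16[of 10] unfolding prod5
    by (simp add: N_def qpochs_inf_def)
  define S where "S = a 40 * (a 9 * a 31 * P 58 * P 22 - q * (a 1 * a 39 * P 42 * P 38))"
  define X where "X = a 12 * a 28 * b 15 * b 25 * b 1 * b 39 * b 9 * b 31"
  define Y where "Y = a 40 * a 10 * a 30 * a 16 * a 24 * b 3 * b 37 * b 13 * b 27"
  \<comment> \<open>\<open>A\<close> supplies, for each \<open>b k\<close> in \<open>X\<close> or
    \<open>Y\<close>, the partner \<open>a k\<close> that merges with it into
    \<open>P (2 * k)\<close>; then only \<open>a\<close> and \<open>P\<close> factors remain to be
    matched.\<close>
  define A where "A = a 3 * a 37 * a 13 * a 27 * a 15 * a 25 * a 1 * a 39 * a 9 * a 31"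
  have 1: "a 9 * a 31 * P 58 * P 22 * (b 9 * b 31) = a 18 * a 22"
  proof -
    have "a 9 * a 31 * P 58 * P 22 * (b 9 * b 31) = (b 9 * a 9) * (b 31 * a 31) * P 58 * P 22"
      by (simp only: mult_ac)
    thus ?thesis unfolding ab aP[of 18] aP[of 22] by simp
  qed
  have 2: "a 1 * a 39 * P 42 * P 38 * (b 1 * b 39) = a 2 * a 38"
  proof -
    have "a 1 * a 39 * P 42 * P 38 * (b 1 * b 39) = (b 1 * a 1) * (b 39 * a 39) * P 42 * P 38"
      by (simp only: mult_ac)
    thus ?thesis unfolding ab aP[of 2] aP[of 38] by simp
  qed
  have "S * X = a 40 * (a 12 * a 28 * b 15 * b 25 *
      ((a 9 * a 31 * P 58 * P 22 * (b 9 * b 31)) * b 1 * b 39 - q * ((a 1 * a 39 * P 42 * P 38 * (b 1 * b 39)) * b 9 * b 31)))"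
    unfolding S_def X_def by (simp add: algebra_simps)
  also have "\<dots> = Y"
    unfolding 1 2 using theta_base_40_relation[OF assms(1,2)] by (simp add: a_def b_def Y_def mult_ac)
  finally have SX: "S * X = Y" .
  have "Y * D * A = (b 3 * a 3) * (b 37 * a 37) * (b 13 * a 13) * (b 27 * a 27)
      * (a 10 * a 30 * a 2 * a 22 * a 18 * a 38)
      * (a 7 * a 12 * a 17 * a 27 * a 32 * a 37 * a 3 * a 8 * a 13 * a 23 * a 28 * a 33)
      * (a 40 * a 16 * a 24 * a 15 * a 25 * a 1 * a 39 * a 9 * a 31)"
    unfolding Y_def D A_def by (simp only: mult_ac)
  also have "\<dots> = (P 6 * P 74 * P 26 * P 54)
      * (P 10 * P 50 * P 30 * P 70 * P 2 * P 42 * P 22 * P 62 * P 18 * P 58 * P 38 * P 78)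
      * (a 7 * a 12 * a 17 * a 27 * a 32 * a 37 * a 3 * a 8 * a 13 * a 23 * a 28 * a 33)
      * (a 40 * a 16 * a 24 * a 15 * a 25 * a 1 * a 39 * a 9 * a 31)"
    unfolding ab aP[of 10] aP[of 30] aP[of 2] aP[of 22] aP[of 18] aP[of 38] by (simp add: mult_ac)
  also have "\<dots> = N * (a 12 * a 28 * (a 3 * a 37 * a 13 * a 27)) * (P 30 * P 50 * P 2 * P 78 * P 18 * P 62)"
    unfolding N by (simp only: mult_ac)
  also have "P 30 * P 50 * P 2 * P 78 * P 18 * P 62
      = (b 15 * a 15) * (b 25 * a 25) * (b 1 * a 1) * (b 39 * a 39) * (b 9 * a 9) * (b 31 * a 31)"
    unfolding ab by simp
  also have "N * (a 12 * a 28 * (a 3 * a 37 * a 13 * a 27)) * \<dots> = N * X * A"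
    unfolding X_def A_def by (simp only: mult_ac)
  finally have "Y * D = N * X"
    using a0 by (simp add: A_def)
  hence "S * D = N"
    unfolding SX[symmetric] using a0 b0 by (simp add: X_def)
  hence "S = N / D" using D0 by (simp add: field_simps)
  thus ?thesis unfolding S_def N_def D_def .
qed

theorem theorem8:
  fixes q :: complex
  assumes "norm q < 1"
  shows "(\<lambda>n. (-1) ^ nat \<lfloor>5 * real n / 4\<rfloor> * q ^ a_seq n) sums
    (qpochs_inf [q, q ^ 7, q ^ 8] (q ^ 8) * qpochs_inf [q ^ 6, q ^ 10] (q ^ 16)
      / qpochs_inf [q ^ 2, q ^ 3] (q ^ 5))"
proof (cases "q = 0")
  case False
  show ?thesis
    using has_sum_imp_sums[OF has_sum_a_seq[OF assms False]]
    unfolding jacobi_theta_sum_eq_quintuple_difference[OF assms False] quintuple_difference_eq_quotient[OF assms False] .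
next
  \<comment> \<open>The two-sided series require \<open>q \<noteq> 0\<close>. At
    \<open>q = 0\<close> only the term with exponent \<open>a_seq 0 = 0\<close> survives, and every
    Pochhammer product is 1.\<close>
  case True
  have a0: "a_seq 0 = 0"
    using a_seq_explicit[of 0 0] by (simp add: class_offset_def)
  have "a_seq n \<noteq> 0" if "n \<noteq> 0" for n
    using strict_monoD[OF strict_mono_a_seq, of 0 n] that by simp
  hence "(\<lambda>n. (-1) ^ nat \<lfloor>5 * real n / 4\<rfloor> * q ^ a_seq n) = (\<lambda>n. if n = 0 then 1 else 0)"
    using a0 True by (auto simp: fun_eq_iff)
  moreover have "(\<lambda>n. if n = 0 then 1 else 0 :: complex) sums 1"
    using sums_single[of 0 "\<lambda>_. 1 :: complex"] by simp
  ultimately show ?thesis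
    using True by (simp add: qpochs_inf_def qpoch_inf_def)
qed

end
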